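(* Let $R$ be a commutative semiring. Let $F_{D_R}:\mathrm{sSet}\to\mathrm{sSet}_{D_R}$ be the functor that is the identity on objects and sends $f:X\to Y$ to $\delta_Y\circ f:X\to D_R(Y)$. The transpose of $F_{D_R}$ with respect to the free–forgetful adjunction $D_R:\mathrm{Cat}\rightleftarrows\mathrm{ConvCat}_R:U$ is the functor $\Theta:D_R(\mathrm{sSet})\to\mathrm{sSet}_{D_R}$ defined as the identity on objects and as the map $\Theta_{X,Y}:D_R(\mathrm{sSet}(X,Y))\to\mathrm{sSet}(X,D_R(Y))$ on morphisms.
   Context: For a set $S$, $D_R(S)$ is the set of functions $p:S\to R$ of finite support with $\sum_s p(s)=1$; for $f:S\to T$, $D_R(f)(p)(t)=\sum_{f(s)=t}p(s)$. It is a monad on $\mathrm{Set}$ with unit $\delta_S(s)=\delta^s$ (delta distribution) and multiplication $\mu_S(P)(s)=\sum_pP(p)p(s)$. Applied degreewise it gives a monad $D_R$ on simplicial sets with unit $\delta_Y:Y\to D_R(Y)$. For simplicial sets $X,Y$, $\Theta_{X,Y}(d)_n(x)=\sum_{\varphi\in\mathrm{sSet}(X,Y)}d(\varphi)\delta^{\varphi_n(x)}$ for $x\in X_n$. $D_R$ also gives a monad on the category $\mathrm{Cat}$ of locally small categories: $D_R(\mathcal C)$ has the same objects as $\mathcal C$, morphism sets $D_R(\mathcal C(X,Y))$, identities $\delta^{\mathrm{Id}_X}$, composition $(q*p)(f)=\sum_{g_2\circ g_1=f}q(g_2)p(g_1)$; for a functor $F$, $D_R(F)$ acts as $F$ on objects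 and as $D_R(F_{X,Y})$ on morphisms; unit and multiplication are the identity on objects and $\delta_{\mathcal C(X,Y)}$, $\mu_{\mathcal C(X,Y)}$ on morphisms. An $R$-convex category is an algebra $(\mathcal C,\pi^{\mathcal C}:D_R(\mathcal C)\to\mathcal C)$ over this monad; these form the category $\mathrm{ConvCat}_R$. The functor $U$ forgets the structure map, and its left adjoint sends $\mathcal C$ to the free algebra $(D_R(\mathcal C),\mu_{\mathcal C})$. The Kleisli category $\mathrm{sSet}_{D_R}$ has simplicial sets as objects, morphism sets $\mathrm{sSet}(X,D_R(Y))$, identities $\delta_X$, and composition $(q\diamond p)_n(x)=\sum_{y\in Y_n}p_n(x)(y)\,q_n(y)$. It is an $R$-convex category with structure functor the identity on objects and $\pi(Q)_n(x)=\sum_{p\in\mathrm{sSet}(X,D_R(Y))}Q(p)p_n(x)$ on morphisms. *)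

theory Defs
  imports "HOL-Library.FuncSet"
begin

section \<open>Categories and functors\<close>

text \<open>
  Hom-sets are indexed by their end points and need not be disjoint, so the composition
  carries the three objects: \<open>Comp C X Y Z g f\<close> is the composite of \<open>f \<in> Hom C X Y\<close>
  and \<open>g \<in> Hom C Y Z\<close>.
\<close>

record ('o, 'm) precat =
  Obj :: "'o set"
  Hom :: "'o \<Rightarrow> 'o \<Rightarrow> 'm set"
  Ident :: "'o \<Rightarrow> 'm"
  Comp :: "'o \<Rightarrow> 'o \<Rightarrow> 'o \<Rightarrow> 'm \<Rightarrow> 'm \<Rightarrow> 'm"

definition category :: "('o, 'm) precat \<Rightarrow> bool" where
  "category C \<longleftrightarrow>
     (\<forall>X Y. Hom C X Y \<noteq> {} \<longrightarrow> X \<in> Obj C \<and> Y \<in> Obj C) \<and>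
     (\<forall>X \<in> Obj C. Ident C X \<in> Hom C X X) \<and>
     (\<forall>X Y Z. \<forall>f \<in> Hom C X Y. \<forall>g \<in> Hom C Y Z. Comp C X Y Z g f \<in> Hom C X Z) \<and>
     (\<forall>X Y. \<forall>f \<in> Hom C X Y.
        Comp C X Y Y (Ident C Y) f = f \<and> Comp C X X Y f (Ident C X) = f) \<and>
     (\<forall>W X Y Z. \<forall>f \<in> Hom C W X. \<forall>g \<in> Hom C X Y. \<forall>h \<in> Hom C Y Z.
        Comp C W Y Z h (Comp C W X Y g f) = Comp C W X Z (Comp C X Y Z h g) f)"

definition op_cat :: "('o, 'm) precat \<Rightarrow> ('o, 'm) precat" where
  "op_cat C = \<lparr>Obj = Obj C, Hom = (\<lambda>X Y. Hom C Y X), Ident = Ident C,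
     Comp = (\<lambda>X Y Z g f. Comp C Z Y X f g)\<rparr>"

record ('o, 'm, 'p, 'n) cfunctor =
  obj_map :: "'o \<Rightarrow> 'p"
  mor_map :: "'o \<Rightarrow> 'o \<Rightarrow> 'm \<Rightarrow> 'n"

text \<open>
  Functors are extensional (\<open>undefined\<close> off the objects and hom-sets of the domain),
  so that equality in HOL is equality of functors.
\<close>

definition functors :: "('o, 'm) precat \<Rightarrow> ('p, 'n) precat \<Rightarrow> ('o, 'm, 'p, 'n) cfunctor set" where
  "functors C D = {F.
     obj_map F \<in> Obj C \<rightarrow>\<^sub>E Obj D \<and>
     (\<forall>X Y. mor_map F X Y \<in> Hom C X Y \<rightarrow>\<^sub>E Hom D (obj_map F X) (obj_map F Y)) \<and>
     (\<forall>X \<in> Obj C. mor_map F X X (Ident C X) = Ident D (obj_map F X)) \<and>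
     (\<forall>X Y Z. \<forall>f \<in> Hom C X Y. \<forall>g \<in> Hom C Y Z.
        mor_map F X Z (Comp C X Y Z g f) =
        Comp D (obj_map F X) (obj_map F Y) (obj_map F Z) (mor_map F Y Z g) (mor_map F X Y f))}"

definition id_functor :: "('o, 'm) precat \<Rightarrow> ('o, 'm, 'o, 'm) cfunctor" where
  "id_functor C = \<lparr>obj_map = (\<lambda>X \<in> Obj C. X), mor_map = (\<lambda>X Y. \<lambda>f \<in> Hom C X Y. f)\<rparr>"

text \<open>\<open>comp_functor C G F\<close> is the composite \<open>G \<circ> F\<close>, where \<open>C\<close> is the domain of \<open>F\<close>.\<close>

definition comp_functor ::
  "('o, 'm) precat \<Rightarrow> ('p, 'n, 'q, 'k) cfunctor \<Rightarrow> ('o, 'm, 'p, 'n) cfunctor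
    \<Rightarrow> ('o, 'm, 'q, 'k) cfunctor" where
  "comp_functor C G F =
     \<lparr>obj_map = (\<lambda>X \<in> Obj C. obj_map G (obj_map F X)),
      mor_map = (\<lambda>X Y. \<lambda>f \<in> Hom C X Y. mor_map G (obj_map F X) (obj_map F Y) (mor_map F X Y f))\<rparr>"

definition set_cat :: "('a set, 'a \<Rightarrow> 'a) precat" where
  "set_cat = \<lparr>Obj = UNIV, Hom = (\<lambda>A B. A \<rightarrow>\<^sub>E B), Ident = (\<lambda>A. \<lambda>x \<in> A. x),
     Comp = (\<lambda>A B C g f. compose A g f)\<rparr>"


section \<open>The distribution monad on sets\<close>

text \<open>
  Commutative semirings are rendered by the sort \<open>{comm_semiring_0, comm_monoid_mult}\<close>:
  \<open>comm_semiring_1\<close> would in addition require \<open>0 \<noteq> 1\<close>.  A function \<open>S \<rightarrow> R\<close> of finite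
  support is represented by its extension by zero, and sums over a possibly infinite set
  of a finitely supported family are taken over the support.
\<close>

definition dist :: "'a set \<Rightarrow> ('a \<Rightarrow> 'r::{comm_semiring_0, comm_monoid_mult}) set" where
  "dist S = {p. finite {s. p s \<noteq> 0} \<and> {s. p s \<noteq> 0} \<subseteq> S \<and> (\<Sum>s | p s \<noteq> 0. p s) = 1}"

definition delta :: "'a \<Rightarrow> 'a \<Rightarrow> 'r::{comm_semiring_0, comm_monoid_mult}" where
  "delta s = (\<lambda>t. if t = s then 1 else 0)"

definition dist_map ::
  "('a \<Rightarrow> 'b) \<Rightarrow> ('a \<Rightarrow> 'r) \<Rightarrow> 'b \<Rightarrow> 'r::{comm_semiring_0, comm_monoid_mult}" where
  "dist_map f p = (\<lambda>t. \<Sum>s | p s \<noteq> 0 \<and> f s = t. p s)"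

definition dist_join ::
  "(('a \<Rightarrow> 'r) \<Rightarrow> 'r) \<Rightarrow> 'a \<Rightarrow> 'r::{comm_semiring_0, comm_monoid_mult}" where
  "dist_join P = (\<lambda>s. \<Sum>p | P p \<noteq> 0. P p * p s)"

definition dist_functor ::
  "('a set, 'a \<Rightarrow> 'a, ('a \<Rightarrow> 'r) set,
    ('a \<Rightarrow> 'r) \<Rightarrow> 'a \<Rightarrow> 'r::{comm_semiring_0, comm_monoid_mult}) cfunctor" where
  "dist_functor =
     \<lparr>obj_map = dist,
      mor_map = (\<lambda>A B. \<lambda>f \<in> Hom set_cat A B. \<lambda>p \<in> dist A. dist_map f p)\<rparr>"


section \<open>Simplicial sets\<close>

text \<open>\<open>simplex_cat\<close> is the simplex category, the number \<open>n\<close> standing for the ordinal \<open>{0, \<dots>, n}\<close>.\<close>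

definition simplex_cat :: "(nat, nat \<Rightarrow> nat) precat" where
  "simplex_cat = \<lparr>Obj = UNIV, Hom = (\<lambda>m n. {\<theta> \<in> {..m} \<rightarrow>\<^sub>E {..n}. mono_on {..m} \<theta>}),
     Ident = (\<lambda>n. \<lambda>i \<in> {..n}. i), Comp = (\<lambda>k m n g f. compose {..k} g f)\<rparr>"

type_synonym 'a sset = "(nat, nat \<Rightarrow> nat, 'a set, 'a \<Rightarrow> 'a) cfunctor"

type_synonym ('a, 'b) sset_map = "nat \<Rightarrow> 'a \<Rightarrow> 'b"

abbreviation simplices :: "'a sset \<Rightarrow> nat \<Rightarrow> 'a set" where
  "simplices X n \<equiv> obj_map X n"

text \<open>The simplicial sets with simplices in the type \<open>'a\<close>, which plays the role of a universe.\<close>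

definition ssets :: "'a sset set" where
  "ssets = functors (op_cat simplex_cat) set_cat"

text \<open>
  Natural transformations.  The two simplicial sets may live over different types,
  since a map \<open>X \<rightarrow> D\<^sub>R(Y)\<close> goes from type \<open>'a\<close> to type \<open>'a \<Rightarrow> 'r\<close>.
\<close>

definition sset_maps :: "'a sset \<Rightarrow> 'b sset \<Rightarrow> ('a, 'b) sset_map set" where
  "sset_maps X Y = {\<phi>.
     (\<forall>n. \<phi> n \<in> simplices X n \<rightarrow>\<^sub>E simplices Y n) \<and>
     (\<forall>m n. \<forall>\<theta> \<in> Hom simplex_cat m n. \<forall>x \<in> simplices X n.
        \<phi> m (mor_map X n m \<theta> x) = mor_map Y n m \<theta> (\<phi> n x))}"

definition sset_comp ::
  "'a sset \<Rightarrow> ('b, 'c) sset_map \<Rightarrow> ('a, 'b) sset_map \<Rightarrow> ('a, 'c) sset_map" where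
  "sset_comp X \<psi> \<phi> = (\<lambda>n. compose (simplices X n) (\<psi> n) (\<phi> n))"

definition sset_cat :: "('a sset, ('a, 'a) sset_map) precat" where
  "sset_cat =
     \<lparr>Obj = ssets,
      Hom = (\<lambda>X Y. {\<phi> \<in> sset_maps X Y. X \<in> ssets \<and> Y \<in> ssets}),
      Ident = (\<lambda>X n. \<lambda>x \<in> simplices X n. x),
      Comp = (\<lambda>X Y Z \<psi> \<phi>. sset_comp X \<psi> \<phi>)\<rparr>"

definition dist_sset ::
  "'a sset \<Rightarrow> ('a \<Rightarrow> 'r::{comm_semiring_0, comm_monoid_mult}) sset" where
  "dist_sset Y = comp_functor (op_cat simplex_cat) dist_functor Y"

definition sset_delta ::
  "'a sset \<Rightarrow> ('a, 'a \<Rightarrow> 'r::{comm_semiring_0, comm_monoid_mult}) sset_map" where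
  "sset_delta Y = (\<lambda>n. \<lambda>y \<in> simplices Y n. delta y)"


section \<open>The distribution monad on categories\<close>

definition dist_cat ::
  "('o, 'm) precat \<Rightarrow> ('o, 'm \<Rightarrow> 'r::{comm_semiring_0, comm_monoid_mult}) precat" where
  "dist_cat C =
     \<lparr>Obj = Obj C,
      Hom = (\<lambda>X Y. {p \<in> dist (Hom C X Y). X \<in> Obj C \<and> Y \<in> Obj C}),
      Ident = (\<lambda>X. delta (Ident C X)),
      Comp = (\<lambda>X Y Z q p f.
        \<Sum>(g2, g1) | q g2 \<noteq> 0 \<and> p g1 \<noteq> 0 \<and> Comp C X Y Z g2 g1 = f. q g2 * p g1)\<rparr>"

text \<open>\<open>dist_cat_map C F\<close> is the functor \<open>D\<^sub>R(F)\<close>, where \<open>C\<close> is the domain of \<open>F\<close>.\<close>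

definition dist_cat_map ::
  "('o, 'm) precat \<Rightarrow> ('o, 'm, 'p, 'n) cfunctor
    \<Rightarrow> ('o, 'm \<Rightarrow> 'r, 'p, 'n \<Rightarrow> 'r::{comm_semiring_0, comm_monoid_mult}) cfunctor" where
  "dist_cat_map C F =
     \<lparr>obj_map = obj_map F,
      mor_map = (\<lambda>X Y. \<lambda>p \<in> Hom (dist_cat C) X Y. dist_map (mor_map F X Y) p)\<rparr>"

definition dist_cat_unit ::
  "('o, 'm) precat
    \<Rightarrow> ('o, 'm, 'o, 'm \<Rightarrow> 'r::{comm_semiring_0, comm_monoid_mult}) cfunctor" where
  "dist_cat_unit C =
     \<lparr>obj_map = (\<lambda>X \<in> Obj C. X), mor_map = (\<lambda>X Y. \<lambda>f \<in> Hom C X Y. delta f)\<rparr>"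

definition dist_cat_mult ::
  "('o, 'm) precat
    \<Rightarrow> ('o, ('m \<Rightarrow> 'r) \<Rightarrow> 'r, 'o, 'm \<Rightarrow> 'r::{comm_semiring_0, comm_monoid_mult}) cfunctor" where
  "dist_cat_mult C =
     \<lparr>obj_map = (\<lambda>X \<in> Obj C. X),
      mor_map = (\<lambda>X Y. \<lambda>P \<in> Hom (dist_cat (dist_cat C)) X Y. dist_join P)\<rparr>"


section \<open>Convex categories and the free-forgetful adjunction\<close>

type_synonym ('o, 'm, 'r) conv_cat =
  "('o, 'm) precat \<times> ('o, 'm \<Rightarrow> 'r, 'o, 'm) cfunctor"

definition convex_category ::
  "('o, 'm, 'r::{comm_semiring_0, comm_monoid_mult}) conv_cat \<Rightarrow> bool" where
  "convex_category A \<longleftrightarrow> (case A of (C, \<pi>) \<Rightarrow>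
     category C \<and>
     \<pi> \<in> functors (dist_cat C) C \<and>
     comp_functor C \<pi> (dist_cat_unit C) = id_functor C \<and>
     comp_functor (dist_cat (dist_cat C)) \<pi> (dist_cat_mult C) =
       comp_functor (dist_cat (dist_cat C)) \<pi> (dist_cat_map (dist_cat C) \<pi>))"

definition conv_functors ::
  "('o, 'm, 'r) conv_cat \<Rightarrow> ('p, 'n, 'r::{comm_semiring_0, comm_monoid_mult}) conv_cat
    \<Rightarrow> ('o, 'm, 'p, 'n) cfunctor set" where
  "conv_functors A B = (case A of (C, \<pi>) \<Rightarrow> case B of (D, \<rho>) \<Rightarrow>
     {H \<in> functors C D.
        comp_functor (dist_cat C) H \<pi> = comp_functor (dist_cat C) \<rho> (dist_cat_map C H)})"

definition free_conv ::
  "('o, 'm) precat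
    \<Rightarrow> ('o, 'm \<Rightarrow> 'r, 'r::{comm_semiring_0, comm_monoid_mult}) conv_cat" where
  "free_conv C = (dist_cat C, dist_cat_mult C)"

definition forget :: "('o, 'm, 'r) conv_cat \<Rightarrow> ('o, 'm) precat" where
  "forget A = fst A"

text \<open>
  The hom-set bijection of the adjunction, from convex functors \<open>free_conv C \<rightarrow> A\<close> to
  functors \<open>C \<rightarrow> forget A\<close>, is precomposition with the unit of the adjunction (on morphisms
  the forgetful functor is the identity).  The transpose of a functor \<open>C \<rightarrow> forget A\<close> is
  its preimage under this bijection.
\<close>

definition adj_bij ::
  "('o, 'm) precat
    \<Rightarrow> ('o, 'm \<Rightarrow> 'r::{comm_semiring_0, comm_monoid_mult}, 'p, 'n) cfunctor
    \<Rightarrow> ('o, 'm, 'p, 'n) cfunctor" where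
  "adj_bij C G = comp_functor C G (dist_cat_unit C)"

definition adj_transpose ::
  "('o, 'm) precat \<Rightarrow> ('p, 'n, 'r::{comm_semiring_0, comm_monoid_mult}) conv_cat
    \<Rightarrow> ('o, 'm, 'p, 'n) cfunctor \<Rightarrow> ('o, 'm \<Rightarrow> 'r, 'p, 'n) cfunctor" where
  "adj_transpose C A F = the_inv_into (conv_functors (free_conv C) A) (adj_bij C) F"


section \<open>The Kleisli category\<close>

definition kleisli_cat ::
  "('a sset, ('a, 'a \<Rightarrow> 'r::{comm_semiring_0, comm_monoid_mult}) sset_map) precat" where
  "kleisli_cat =
     \<lparr>Obj = ssets,
      Hom = (\<lambda>X Y. {p \<in> sset_maps X (dist_sset Y). X \<in> ssets \<and> Y \<in> ssets}),
      Ident = sset_delta,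
      Comp = (\<lambda>X Y Z q p n. \<lambda>x \<in> simplices X n. \<lambda>z. \<Sum>y | p n x y \<noteq> 0. p n x y * q n y z)\<rparr>"

definition kleisli_struct ::
  "('a sset, ('a, 'a \<Rightarrow> 'r) sset_map \<Rightarrow> 'r, 'a sset,
    ('a, 'a \<Rightarrow> 'r::{comm_semiring_0, comm_monoid_mult}) sset_map) cfunctor" where
  "kleisli_struct =
     \<lparr>obj_map = (\<lambda>X \<in> ssets. X),
      mor_map = (\<lambda>X Y. \<lambda>Q \<in> Hom (dist_cat kleisli_cat) X Y.
        \<lambda>n. \<lambda>x \<in> simplices X n. \<lambda>y. \<Sum>p | Q p \<noteq> 0. Q p * p n x y)\<rparr>"

definition kleisli_conv ::
  "('a sset, ('a, 'a \<Rightarrow> 'r) sset_map, 'r::{comm_semiring_0, comm_monoid_mult}) conv_cat" where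
  "kleisli_conv = (kleisli_cat, kleisli_struct)"

definition F_functor ::
  "('a sset, ('a, 'a) sset_map, 'a sset,
    ('a, 'a \<Rightarrow> 'r::{comm_semiring_0, comm_monoid_mult}) sset_map) cfunctor" where
  "F_functor =
     \<lparr>obj_map = (\<lambda>X \<in> ssets. X),
      mor_map = (\<lambda>X Y. \<lambda>f \<in> Hom sset_cat X Y. sset_comp X (sset_delta Y) f)\<rparr>"

definition Theta ::
  "'a sset \<Rightarrow> 'b sset \<Rightarrow> (('a, 'b) sset_map \<Rightarrow> 'r)
    \<Rightarrow> ('a, 'b \<Rightarrow> 'r::{comm_semiring_0, comm_monoid_mult}) sset_map" where
  "Theta X Y d =
     (\<lambda>n. \<lambda>x \<in> simplices X n. \<lambda>y.
        \<Sum>\<phi> | \<phi> \<in> sset_maps X Y \<and> d \<phi> \<noteq> 0. d \<phi> * delta (\<phi> n x) y)"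

definition Theta_functor ::
  "('a sset, ('a, 'a) sset_map \<Rightarrow> 'r, 'a sset,
    ('a, 'a \<Rightarrow> 'r::{comm_semiring_0, comm_monoid_mult}) sset_map) cfunctor" where
  "Theta_functor =
     \<lparr>obj_map = (\<lambda>X \<in> ssets. X),
      mor_map = (\<lambda>X Y. \<lambda>d \<in> Hom (dist_cat sset_cat) X Y. Theta X Y d)\<rparr>"

end

theory Submission
  imports Defs
begin

text \<open>
  All operations of the statement are instances of the Kleisli extension
  \<open>dist_bind p k = (\<lambda>t. \<Sum>s. p s * k s t)\<close> of the distribution monad, so the coherence laws reduce
  to the unit laws, associativity and commutativity of \<open>dist_bind\<close>.  The transpose of a functor
  \<open>F\<close> into a convex category with structure map \<open>\<pi>\<close> is \<open>\<pi> \<circ> D\<^sub>R(F)\<close>; for \<open>F_functor\<close> this sends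
  \<open>d\<close> to the map \<open>x \<mapsto> \<Sum>\<phi>. d \<phi> * delta (\<phi> x)\<close>, which is \<open>Theta\<close>.
\<close>

section \<open>The distribution monad\<close>

text \<open>Composition in \<open>dist_cat\<close> draws its two morphisms independently. The join
  and the Kleisli structure map respect it because the order of independent draws can be exchanged,
  and this is where commutativity of multiplication enters; the other laws keep the order of the
  draws. Two obstacles shape the rest. The support of a \<open>dist_bind\<close> can be smaller than
  the supports of its parts suggest: sums and products may vanish, and if 1 = 0 even
  \<open>delta s\<close> has empty support. Hence sums are taken over finite supersets of supports.
  Moreover, functors and simplicial maps are extensional, so their values are known only on hom-sets
  and simplices. A variable bound by \<open>dist_bind\<close> must therefore be known to lie in the
  support, and a compound argument of a restricted map needs its own membership fact.\<close>

definition dist_bind ::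
  "('a \<Rightarrow> 'r) \<Rightarrow> ('a \<Rightarrow> 'b \<Rightarrow> 'r) \<Rightarrow> 'b \<Rightarrow> 'r::{comm_semiring_0, comm_monoid_mult}" where
  "dist_bind p k = (\<lambda>t. \<Sum>s | p s \<noteq> 0. p s * k s t)"

text \<open>The algebraic laws of \<open>dist_bind\<close> depend on finiteness only and not on
  total mass one, so this condition is separated from \<open>dist\<close>.\<close>

definition fin_supp :: "('a \<Rightarrow> 'r::zero) \<Rightarrow> bool" where
  "fin_supp p \<longleftrightarrow> finite {s. p s \<noteq> 0}"

text \<open>As a congruence rule it makes the simplifier assume \<open>p' s \<noteq> 0\<close> while
  rewriting \<open>k s\<close>. Conditional rules on morphisms or simplices thus become applicable
  under the binder, given that the support of \<open>p'\<close> consists of such elements.\<close>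

lemma dist_bind_cong [cong]:
  assumes "p = p'" "\<And>s. p' s \<noteq> 0 \<Longrightarrow> k s = k' s"
  shows "dist_bind p k = dist_bind p' k'"
  unfolding dist_bind_def using assms by (auto intro!: ext sum.cong)

lemma sum_support_superset:
  fixes p :: "'a \<Rightarrow> 'r::{comm_semiring_0, comm_monoid_mult}"
  assumes "finite A" "{s. p s \<noteq> 0} \<subseteq> A"
  shows "(\<Sum>s | p s \<noteq> 0. p s * g s) = (\<Sum>s\<in>A. p s * g s)"
  using assms by (intro sum.mono_neutral_left) auto

text \<open>A nonzero sum has a nonzero summand. Only an inclusion holds, since summands may cancel
  and nonzero factors may have product zero.\<close>

lemma dist_bind_support:
  "{t. dist_bind p k t \<noteq> 0} \<subseteq> (\<Union>s\<in>{s. p s \<noteq> 0}. {t. k s t \<noteq> 0})"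
proof
  fix t assume "t \<in> {t. dist_bind p k t \<noteq> 0}"
  then have "(\<Sum>s | p s \<noteq> 0. p s * k s t) \<noteq> 0" by (simp add: dist_bind_def)
  then obtain s where "p s \<noteq> 0" "p s * k s t \<noteq> 0" by (metis (mono_tags, lifting) mem_Collect_eq sum.neutral)
  then show "t \<in> (\<Union>s\<in>{s. p s \<noteq> 0}. {t. k s t \<noteq> 0})" by auto
qed

lemma fin_supp_bind [simp]:
  assumes "fin_supp p" "\<And>s. p s \<noteq> 0 \<Longrightarrow> fin_supp (k s)"
  shows "fin_supp (dist_bind p k)"
  using assms unfolding fin_supp_def
  by (intro finite_subset[OF dist_bind_support]) auto

lemma fin_supp_delta [simp]: "fin_supp (delta s)"
  unfolding fin_supp_def delta_def by (rule finite_subset[of _ "{s}"]) auto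

text \<open>The support of \<open>dist_bind p k\<close> and those of the \<open>k s\<close> are
  different index sets. Both are enlarged to the finite union \<open>?U\<close>, after which the
  double sum can be swapped.\<close>

lemma dist_bind_assoc:
  assumes p: "fin_supp p" and k: "\<And>s. p s \<noteq> 0 \<Longrightarrow> fin_supp (k s)"
  shows "dist_bind (dist_bind p k) l = dist_bind p (\<lambda>s. dist_bind (k s) l)"
proof
  fix t
  let ?U = "\<Union>s\<in>{s. p s \<noteq> 0}. {u. k s u \<noteq> 0}"
  have fin: "finite ?U" using p k by (auto simp: fin_supp_def)
  have "dist_bind (dist_bind p k) l t = (\<Sum>u\<in>?U. dist_bind p k u * l u t)"
    unfolding dist_bind_def[of "dist_bind p k"]
    by (rule sum_support_superset[OF fin dist_bind_support])
  also have "\<dots> = (\<Sum>u\<in>?U. \<Sum>s | p s \<noteq> 0. p s * (k s u * l u t))"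
    by (simp add: dist_bind_def sum_distrib_right mult.assoc)
  also have "\<dots> = (\<Sum>s | p s \<noteq> 0. p s * (\<Sum>u\<in>?U. k s u * l u t))"
    by (subst sum.swap) (simp add: sum_distrib_left)
  also have "\<dots> = (\<Sum>s | p s \<noteq> 0. p s * dist_bind (k s) l t)"
    unfolding dist_bind_def[of "k _"]
    by (intro sum.cong refl arg_cong2[where f = "(*)"] sum_support_superset[symmetric] fin) auto
  finally show "dist_bind (dist_bind p k) l t = dist_bind p (\<lambda>s. dist_bind (k s) l) t"
    by (simp add: dist_bind_def[of p])
qed

lemma dist_bind_delta_left [simp]: "dist_bind (delta s) k = k s"
proof
  fix t
  \<comment> \<open>The set \<open>{s}\<close> is used instead of the support of
    \<open>delta s\<close>, which is empty when 1 = 0.\<close>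
  have "dist_bind (delta s) k t = (\<Sum>u\<in>{s}. delta s u * k u t)"
    unfolding dist_bind_def by (rule sum_support_superset) (auto simp: delta_def)
  then show "dist_bind (delta s) k t = k s t" by (simp add: delta_def)
qed

lemma dist_bind_delta_right [simp]:
  assumes "fin_supp p" shows "dist_bind p delta = p"
proof
  fix t
  \<comment> \<open>Inserting \<open>t\<close> avoids a case distinction: outside the support its
    term is \<open>p t = 0\<close>.\<close>
  have "dist_bind p delta t = (\<Sum>s\<in>insert t {s. p s \<noteq> 0}. p s * delta s t)"
    unfolding dist_bind_def using assms by (intro sum_support_superset) (auto simp: fin_supp_def)
  also have "\<dots> = (\<Sum>s\<in>insert t {s. p s \<noteq> 0}. if t = s then p s else 0)"
    by (intro sum.cong) (auto simp: delta_def)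
  finally show "dist_bind p delta t = p t" using assms by (simp add: fin_supp_def)
qed

text \<open>This is Fubini for independent draws, i.e. commutativity of the monad. Neither support
  depends on the other variable, so the sums swap directly; \<open>ac_simps\<close> then exchanges
  the two weights.\<close>

lemma dist_bind_commute:
  "dist_bind p (\<lambda>s. dist_bind q (k s)) = dist_bind q (\<lambda>t. dist_bind p (\<lambda>s. k s t))"
proof
  fix u
  show "dist_bind p (\<lambda>s. dist_bind q (k s)) u = dist_bind q (\<lambda>t. dist_bind p (\<lambda>s. k s t)) u"
    unfolding dist_bind_def sum_distrib_left
    by (subst sum.swap) (simp add: ac_simps)
qed

lemma dist_map_eq_bind:
  assumes "fin_supp p" shows "dist_map f p = dist_bind p (\<lambda>s. delta (f s))"
proof
  fix t
  have "dist_map f p t = (\<Sum>s\<in>{s \<in> {s. p s \<noteq> 0}. f s = t}. p s)"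
    by (simp add: dist_map_def)
  also have "\<dots> = (\<Sum>s | p s \<noteq> 0. if f s = t then p s else 0)"
    using assms by (intro sum.inter_filter) (simp add: fin_supp_def)
  also have "\<dots> = dist_bind p (\<lambda>s. delta (f s)) t"
    unfolding dist_bind_def by (intro sum.cong) (auto simp: delta_def)
  finally show "dist_map f p t = dist_bind p (\<lambda>s. delta (f s)) t" .
qed

lemma dist_join_eq_bind: "dist_join P = dist_bind P (\<lambda>p. p)"
  by (simp add: dist_join_def dist_bind_def)

text \<open>Total mass one is expressed as pushing forward to the one-point type \<open>unit\<close>
  and obtaining its delta. The mass condition thereby becomes an equation between binds, to which
  associativity applies.\<close>

lemma dist_iff:
  "p \<in> dist S \<longleftrightarrow>
     fin_supp p \<and> (\<forall>s. p s \<noteq> 0 \<longrightarrow> s \<in> S) \<and> dist_bind p (\<lambda>_. delta ()) = delta ()"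
  by (auto simp: dist_def fin_supp_def dist_bind_def delta_def fun_eq_iff)

lemma dist_fin_supp: "p \<in> dist S \<Longrightarrow> fin_supp p"
  by (simp add: dist_iff)

lemma dist_support: "p \<in> dist S \<Longrightarrow> p s \<noteq> 0 \<Longrightarrow> s \<in> S"
  by (simp add: dist_iff)

lemma delta_support: "delta s t \<noteq> 0 \<Longrightarrow> t = s"
  by (auto simp: delta_def split: if_splits)

lemma delta_in_dist: "s \<in> S \<Longrightarrow> delta s \<in> dist S"
  by (auto simp: dist_iff dest: delta_support)

text \<open>By associativity the total mass is computed inside first: each \<open>k s\<close> on the
  support of \<open>p\<close> has mass one, which leaves the mass of \<open>p\<close>.\<close>

lemma dist_bind_in_dist:
  assumes p: "p \<in> dist S" and k: "\<And>s. s \<in> S \<Longrightarrow> k s \<in> dist T"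
  shows "dist_bind p k \<in> dist T"
proof -
  have k': "k s \<in> dist T" if "p s \<noteq> 0" for s using k dist_support[OF p that] .
  have "t \<in> T" if "dist_bind p k t \<noteq> 0" for t
    using dist_bind_support[of p k] that k' by (auto dest: dist_support)
  then show ?thesis
    using p k' unfolding dist_iff[of _ T] by (simp add: dist_bind_assoc dist_iff)
qed

section \<open>Categories and functors\<close>

lemma category_objects: "category C \<Longrightarrow> f \<in> Hom C X Y \<Longrightarrow> X \<in> Obj C \<and> Y \<in> Obj C"
  unfolding category_def by blast

lemma category_ident: "category C \<Longrightarrow> X \<in> Obj C \<Longrightarrow> Ident C X \<in> Hom C X X"
  unfolding category_def by blast

lemma category_comp:
  "category C \<Longrightarrow> f \<in> Hom C X Y \<Longrightarrow> g \<in> Hom C Y Z \<Longrightarrow> Comp C X Y Z g f \<in> Hom C X Z"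
  unfolding category_def by blast

lemma category_ident_left:
  "category C \<Longrightarrow> f \<in> Hom C X Y \<Longrightarrow> Comp C X Y Y (Ident C Y) f = f"
  unfolding category_def by blast

lemma category_ident_right:
  "category C \<Longrightarrow> f \<in> Hom C X Y \<Longrightarrow> Comp C X X Y f (Ident C X) = f"
  unfolding category_def by blast

lemma category_assoc:
  "category C \<Longrightarrow> f \<in> Hom C W X \<Longrightarrow> g \<in> Hom C X Y \<Longrightarrow> h \<in> Hom C Y Z \<Longrightarrow>
    Comp C W Y Z h (Comp C W X Y g f) = Comp C W X Z (Comp C X Y Z h g) f"
  unfolding category_def by blast

lemma functor_obj: "F \<in> functors C D \<Longrightarrow> X \<in> Obj C \<Longrightarrow> obj_map F X \<in> Obj D"
  unfolding functors_def by auto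

lemma functor_mor:
  "F \<in> functors C D \<Longrightarrow> f \<in> Hom C X Y \<Longrightarrow>
    mor_map F X Y f \<in> Hom D (obj_map F X) (obj_map F Y)"
  unfolding functors_def by (auto simp: PiE_iff)

lemma functor_ident:
  "F \<in> functors C D \<Longrightarrow> X \<in> Obj C \<Longrightarrow> mor_map F X X (Ident C X) = Ident D (obj_map F X)"
  unfolding functors_def by auto

lemma functor_comp:
  "F \<in> functors C D \<Longrightarrow> f \<in> Hom C X Y \<Longrightarrow> g \<in> Hom C Y Z \<Longrightarrow>
    mor_map F X Z (Comp C X Y Z g f) =
    Comp D (obj_map F X) (obj_map F Y) (obj_map F Z) (mor_map F Y Z g) (mor_map F X Y f)"
  unfolding functors_def by blast

lemma functor_obj_extensional: "F \<in> functors C D \<Longrightarrow> obj_map F \<in> extensional (Obj C)"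
  unfolding functors_def by (simp add: PiE_iff)

lemma functor_mor_extensional: "F \<in> functors C D \<Longrightarrow> mor_map F X Y \<in> extensional (Hom C X Y)"
  unfolding functors_def by (simp add: PiE_iff)

text \<open>Extensionality on the common domain suffices, so the codomains \<open>D\<close> and
  \<open>D'\<close> may differ.\<close>

lemma functor_eqI:
  assumes F: "F \<in> functors C D" and G: "G \<in> functors C D'"
    and "\<And>X. X \<in> Obj C \<Longrightarrow> obj_map F X = obj_map G X"
    and "\<And>X Y f. f \<in> Hom C X Y \<Longrightarrow> mor_map F X Y f = mor_map G X Y f"
  shows "F = G"
proof -
  have "obj_map F = obj_map G"
    by (rule extensionalityI[OF functor_obj_extensional[OF F] functor_obj_extensional[OF G]])
      (rule assms(3))
  moreover have "mor_map F X Y = mor_map G X Y" for X Y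
    by (rule extensionalityI[OF functor_mor_extensional[OF F] functor_mor_extensional[OF G]])
      (rule assms(4))
  ultimately show ?thesis by (auto intro!: cfunctor.equality)
qed

lemma comp_functor_obj [simp]:
  "X \<in> Obj C \<Longrightarrow> obj_map (comp_functor C G F) X = obj_map G (obj_map F X)"
  by (simp add: comp_functor_def)

lemma comp_functor_mor [simp]:
  "f \<in> Hom C X Y \<Longrightarrow> mor_map (comp_functor C G F) X Y f =
    mor_map G (obj_map F X) (obj_map F Y) (mor_map F X Y f)"
  by (simp add: comp_functor_def)

lemma comp_functor_in_functors:
  assumes C: "category C" and F: "F \<in> functors C D" and G: "G \<in> functors D E"
  shows "comp_functor C G F \<in> functors C E"
proof -
  have "mor_map (comp_functor C G F) X Y \<in> Hom C X Y \<rightarrow>\<^sub>E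
      Hom E (obj_map (comp_functor C G F) X) (obj_map (comp_functor C G F) Y)" for X Y
  proof (rule PiE_I)
    fix f assume f: "f \<in> Hom C X Y"
    then show "mor_map (comp_functor C G F) X Y f \<in>
        Hom E (obj_map (comp_functor C G F) X) (obj_map (comp_functor C G F) Y)"
      using category_objects[OF C f] functor_mor[OF G functor_mor[OF F f]] by simp
  qed (simp add: comp_functor_def)
  moreover have "mor_map (comp_functor C G F) X Z (Comp C X Y Z g f) =
      Comp E (obj_map (comp_functor C G F) X) (obj_map (comp_functor C G F) Y)
        (obj_map (comp_functor C G F) Z)
        (mor_map (comp_functor C G F) Y Z g) (mor_map (comp_functor C G F) X Y f)"
    if "f \<in> Hom C X Y" "g \<in> Hom C Y Z" for X Y Z f g
    using that category_objects[OF C that(1)] category_objects[OF C that(2)]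
    by (simp add: category_comp[OF C] functor_comp[OF F] functor_comp[OF G functor_mor functor_mor, OF F _ F])
  moreover have "obj_map (comp_functor C G F) \<in> Obj C \<rightarrow>\<^sub>E Obj E"
    using functor_obj[OF G functor_obj[OF F]] by (auto simp: comp_functor_def)
  moreover have "mor_map (comp_functor C G F) X X (Ident C X) =
      Ident E (obj_map (comp_functor C G F) X)" if "X \<in> Obj C" for X
    using that
    by (simp add: category_ident[OF C] functor_ident[OF F] functor_ident[OF G functor_obj[OF F]])
  ultimately show ?thesis unfolding functors_def by blast
qed

section \<open>The distribution monad on categories\<close>

lemma Obj_dist_cat [simp]: "Obj (dist_cat C) = Obj C"
  by (simp add: dist_cat_def)

lemma Hom_dist_cat:
  "p \<in> Hom (dist_cat C) X Y \<longleftrightarrow> p \<in> dist (Hom C X Y) \<and> X \<in> Obj C \<and> Y \<in> Obj C"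
  by (simp add: dist_cat_def)

lemma Ident_dist_cat [simp]: "Ident (dist_cat C) X = delta (Ident C X)"
  by (simp add: dist_cat_def)

text \<open>The composite is the image of the product distribution of \<open>q\<close> and
  \<open>p\<close> under \<open>Comp C\<close>. The constraint that a pair composes to
  \<open>f\<close> moves into the summand as a \<open>delta\<close> factor, and the sum over pairs
  splits into two nested binds.\<close>

lemma Comp_dist_cat:
  assumes q: "fin_supp q" and p: "fin_supp p"
  shows "Comp (dist_cat C) X Y Z q p =
    dist_bind q (\<lambda>g2. dist_bind p (\<lambda>g1. delta (Comp C X Y Z g2 g1)))"
proof
  fix f
  let ?c = "\<lambda>(g2, g1). Comp C X Y Z g2 g1"
  let ?A = "{g2. q g2 \<noteq> 0} \<times> {g1. p g1 \<noteq> 0}"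
  have fin: "finite ?A" using p q by (simp add: fin_supp_def)
  have "Comp (dist_cat C) X Y Z q p f =
      (\<Sum>g\<in>{g \<in> ?A. ?c g = f}. (\<lambda>(g2, g1). q g2 * p g1) g)"
    by (simp add: dist_cat_def, rule sum.cong) auto
  also have "\<dots> = (\<Sum>g\<in>?A. if ?c g = f then (\<lambda>(g2, g1). q g2 * p g1) g else 0)"
    using fin by (rule sum.inter_filter)
  also have "\<dots> = (\<Sum>(g2, g1)\<in>?A. q g2 * (p g1 * delta (Comp C X Y Z g2 g1) f))"
    by (intro sum.cong) (auto simp: delta_def)
  also have "\<dots> = dist_bind q (\<lambda>g2. dist_bind p (\<lambda>g1. delta (Comp C X Y Z g2 g1))) f"
    by (simp add: dist_bind_def sum_distrib_left sum.cartesian_product)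
  finally show "Comp (dist_cat C) X Y Z q p f =
    dist_bind q (\<lambda>g2. dist_bind p (\<lambda>g1. delta (Comp C X Y Z g2 g1))) f" .
qed

lemma Hom_dist_cat_fin_supp: "p \<in> Hom (dist_cat C) X Y \<Longrightarrow> fin_supp p"
  by (auto simp: Hom_dist_cat intro: dist_fin_supp)

lemma Hom_dist_cat_support: "p \<in> Hom (dist_cat C) X Y \<Longrightarrow> p f \<noteq> 0 \<Longrightarrow> f \<in> Hom C X Y"
  by (auto simp: Hom_dist_cat intro: dist_support)

lemma Comp_dist_cat_in_Hom:
  assumes C: "category C" and p: "p \<in> Hom (dist_cat C) X Y" and q: "q \<in> Hom (dist_cat C) Y Z"
  shows "Comp (dist_cat C) X Y Z q p \<in> Hom (dist_cat C) X Z"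
  using p q
  by (auto simp: Comp_dist_cat Hom_dist_cat_fin_supp[OF p] Hom_dist_cat_fin_supp[OF q] Hom_dist_cat
      intro!: dist_bind_in_dist[of q] dist_bind_in_dist[of p] delta_in_dist category_comp[OF C])

lemma category_dist_cat:
  fixes C :: "('o, 'm) precat"
  assumes C: "category C"
  shows "category (dist_cat C :: ('o, 'm \<Rightarrow> 'r::{comm_semiring_0, comm_monoid_mult}) precat)"
    (is "category ?D")
  unfolding category_def
proof (intro conjI allI ballI impI)
  fix X Y assume "Hom ?D X Y \<noteq> {}"
  then show "X \<in> Obj ?D" "Y \<in> Obj ?D" by (auto simp: Hom_dist_cat)
next
  fix X assume "X \<in> Obj ?D"
  then show "Ident ?D X \<in> Hom ?D X X"
    by (simp add: Hom_dist_cat delta_in_dist category_ident[OF C])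
next
  fix X Y Z f g assume "f \<in> Hom ?D X Y" "g \<in> Hom ?D Y Z"
  then show "Comp ?D X Y Z g f \<in> Hom ?D X Z"
    by (rule Comp_dist_cat_in_Hom[OF C])
next
  fix X Y f assume f: "f \<in> Hom ?D X Y"
  note s = Hom_dist_cat_fin_supp[OF f] Hom_dist_cat_support[OF f]
  show "Comp ?D X Y Y (Ident ?D Y) f = f"
    using s by (simp add: Comp_dist_cat category_ident_left[OF C])
  show "Comp ?D X X Y f (Ident ?D X) = f"
    using s by (simp add: Comp_dist_cat category_ident_right[OF C])
next
  fix W X Y Z f g h
  assume f: "f \<in> Hom ?D W X" and g: "g \<in> Hom ?D X Y"
    and h: "h \<in> Hom ?D Y Z"
  note s = f[THEN Hom_dist_cat_fin_supp] f[THEN Hom_dist_cat_support]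
    g[THEN Hom_dist_cat_fin_supp] g[THEN Hom_dist_cat_support]
    h[THEN Hom_dist_cat_fin_supp] h[THEN Hom_dist_cat_support]
  show "Comp ?D W Y Z h (Comp ?D W X Y g f) =
      Comp ?D W X Z (Comp ?D X Y Z h g) f"
    \<comment> \<open>Both sides flatten to draws from \<open>h\<close>, \<open>g\<close>,
      \<open>f\<close> in this order, followed by a delta at a triple composite. The facts
      \<open>s\<close> place the drawn morphisms in their hom-sets, where
      \<open>category_assoc\<close> identifies the two bracketings.\<close>
    by (simp add: s Comp_dist_cat dist_bind_assoc category_assoc[OF C])
qed

text \<open>The obligations on morphisms carry the end points as objects, as nonempty hom-sets of a
  category guarantee. Object maps restricted to \<open>Obj C\<close> can then be evaluated.\<close>

lemma functorI:
  assumes C: "category C"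
    and "obj_map F \<in> extensional (Obj C)"
    and "\<And>X. X \<in> Obj C \<Longrightarrow> obj_map F X \<in> Obj D"
    and "\<And>X Y. mor_map F X Y \<in> extensional (Hom C X Y)"
    and "\<And>X Y f. X \<in> Obj C \<Longrightarrow> Y \<in> Obj C \<Longrightarrow> f \<in> Hom C X Y \<Longrightarrow>
      mor_map F X Y f \<in> Hom D (obj_map F X) (obj_map F Y)"
    and "\<And>X. X \<in> Obj C \<Longrightarrow> mor_map F X X (Ident C X) = Ident D (obj_map F X)"
    and "\<And>X Y Z f g. X \<in> Obj C \<Longrightarrow> Y \<in> Obj C \<Longrightarrow> Z \<in> Obj C \<Longrightarrow>
      f \<in> Hom C X Y \<Longrightarrow> g \<in> Hom C Y Z \<Longrightarrow>
      mor_map F X Z (Comp C X Y Z g f) =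
      Comp D (obj_map F X) (obj_map F Y) (obj_map F Z) (mor_map F Y Z g) (mor_map F X Y f)"
  shows "F \<in> functors C D"
  unfolding functors_def
proof (intro CollectI conjI allI ballI)
  show "obj_map F \<in> Obj C \<rightarrow>\<^sub>E Obj D" using assms(2,3) by (simp add: PiE_iff)
  show "mor_map F X Y \<in> Hom C X Y \<rightarrow>\<^sub>E Hom D (obj_map F X) (obj_map F Y)" for X Y
    using assms(4,5) category_objects[OF C] by (simp add: PiE_iff)
qed (use assms(6,7) category_objects[OF C] in blast)+

lemma dist_cat_map_obj [simp]: "obj_map (dist_cat_map C F) = obj_map F"
  by (simp add: dist_cat_map_def)

lemma dist_cat_map_mor [simp]:
  "p \<in> Hom (dist_cat C) X Y \<Longrightarrow>
    mor_map (dist_cat_map C F) X Y p = dist_bind p (\<lambda>f. delta (mor_map F X Y f))"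
  by (simp add: dist_cat_map_def dist_map_eq_bind Hom_dist_cat_fin_supp)

lemma dist_cat_unit_obj [simp]: "X \<in> Obj C \<Longrightarrow> obj_map (dist_cat_unit C) X = X"
  by (simp add: dist_cat_unit_def)

lemma dist_cat_unit_mor [simp]:
  "f \<in> Hom C X Y \<Longrightarrow> mor_map (dist_cat_unit C) X Y f = delta f"
  by (simp add: dist_cat_unit_def)

lemma dist_cat_mult_obj [simp]: "X \<in> Obj C \<Longrightarrow> obj_map (dist_cat_mult C) X = X"
  by (simp add: dist_cat_mult_def)

lemma dist_cat_mult_mor [simp]:
  "P \<in> Hom (dist_cat (dist_cat C)) X Y \<Longrightarrow>
    mor_map (dist_cat_mult C) X Y P = dist_bind P (\<lambda>p. p)"
  by (simp add: dist_cat_mult_def dist_join_eq_bind)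

lemma dist_cat_map_in_functors:
  assumes C: "category C" and F: "F \<in> functors C D"
  shows "dist_cat_map C F \<in> functors (dist_cat C) (dist_cat D)"
    (is "_ \<in> functors ?DC ?DD")
proof (rule functorI[OF category_dist_cat[OF C]])
  show "obj_map (dist_cat_map C F) \<in> extensional (Obj ?DC)"
    using functor_obj_extensional[OF F] by simp
  show "mor_map (dist_cat_map C F) X Y \<in> extensional (Hom ?DC X Y)" for X Y
    by (simp add: dist_cat_map_def)
  show "obj_map (dist_cat_map C F) X \<in> Obj ?DD" if "X \<in> Obj ?DC" for X
    using that functor_obj[OF F] by simp
  show in_Hom: "mor_map (dist_cat_map C F) X Y p \<in>
      Hom ?DD (obj_map (dist_cat_map C F) X) (obj_map (dist_cat_map C F) Y)"
    if "p \<in> Hom ?DC X Y" for X Y p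
    using that functor_obj[OF F] functor_mor[OF F]
    by (auto simp: Hom_dist_cat intro!: dist_bind_in_dist[of p] delta_in_dist)
  show "mor_map (dist_cat_map C F) X X (Ident ?DC X) =
      Ident ?DD (obj_map (dist_cat_map C F) X)" if "X \<in> Obj ?DC" for X
    \<comment> \<open>The morphism map is restricted to the hom-set, so it evaluates at the identity
      only once the latter is known to be a morphism.\<close>
    using that category_ident[of ?DC X, OF category_dist_cat[OF C]] functor_ident[OF F] by simp
  show "mor_map (dist_cat_map C F) X Z (Comp ?DC X Y Z q p) =
      Comp ?DD (obj_map (dist_cat_map C F) X) (obj_map (dist_cat_map C F) Y)
        (obj_map (dist_cat_map C F) Z)
        (mor_map (dist_cat_map C F) Y Z q) (mor_map (dist_cat_map C F) X Y p)"
    if p: "p \<in> Hom ?DC X Y" and q: "q \<in> Hom ?DC Y Z" for X Y Z p q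
  proof -
    note s = p[THEN Hom_dist_cat_fin_supp] p[THEN Hom_dist_cat_support]
      q[THEN Hom_dist_cat_fin_supp] q[THEN Hom_dist_cat_support]
    show ?thesis
      using Comp_dist_cat_in_Hom[OF C p q] p q
      by (simp add: s Comp_dist_cat dist_bind_assoc functor_comp[OF F])
  qed
qed

lemma dist_cat_unit_in_functors:
  assumes C: "category C" shows "dist_cat_unit C \<in> functors C (dist_cat C)"
  by (rule functorI[OF C])
    (simp_all add: Hom_dist_cat delta_in_dist category_ident[OF C] category_comp[OF C]
      Comp_dist_cat, simp_all add: dist_cat_unit_def)

lemma dist_cat_mult_in_functors:
  assumes C: "category C"
  shows "dist_cat_mult C \<in> functors (dist_cat (dist_cat C)) (dist_cat C)"
    (is "_ \<in> functors ?DDC ?DC")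
proof (rule functorI[OF category_dist_cat[OF category_dist_cat[OF C]]])
  show "mor_map (dist_cat_mult C) X Y P \<in>
      Hom ?DC (obj_map (dist_cat_mult C) X) (obj_map (dist_cat_mult C) Y)"
    if "P \<in> Hom ?DDC X Y" for X Y P
    using that by (auto simp: Hom_dist_cat[of _ C] Hom_dist_cat[of _ "?DC"]
      intro!: dist_bind_in_dist[of P])
  show "mor_map (dist_cat_mult C) X X (Ident ?DDC X) =
      Ident ?DC (obj_map (dist_cat_mult C) X)" if "X \<in> Obj ?DDC" for X
    using that category_ident[of ?DDC X, OF category_dist_cat[OF category_dist_cat[OF C]]] by simp
  show "mor_map (dist_cat_mult C) X Z (Comp ?DDC X Y Z Q P) =
      Comp ?DC (obj_map (dist_cat_mult C) X) (obj_map (dist_cat_mult C) Y)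
        (obj_map (dist_cat_mult C) Z)
        (mor_map (dist_cat_mult C) Y Z Q) (mor_map (dist_cat_mult C) X Y P)"
    if P: "P \<in> Hom ?DDC X Y" and Q: "Q \<in> Hom ?DDC Y Z"
    for X Y Z P Q
  proof -
    have s: "fin_supp P" "P p \<noteq> 0 \<Longrightarrow> fin_supp p" "fin_supp Q" "Q p \<noteq> 0 \<Longrightarrow> fin_supp p" for p
      using P Q by (auto dest: Hom_dist_cat_support intro: Hom_dist_cat_fin_supp)
    have "mor_map (dist_cat_mult C) X Z (Comp ?DDC X Y Z Q P) =
        dist_bind Q (\<lambda>q. dist_bind P (\<lambda>p. dist_bind q (\<lambda>g. dist_bind p
          (\<lambda>f. delta (Comp C X Y Z g f)))))"
      using Comp_dist_cat_in_Hom[OF category_dist_cat[OF C] P Q]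
      by (simp add: s Comp_dist_cat dist_bind_assoc)
    \<comment> \<open>Joining after composing draws \<open>q\<close>, \<open>p\<close>,
      \<open>g\<close>, \<open>f\<close>; composing after joining draws \<open>q\<close>,
      \<open>g\<close>, \<open>p\<close>, \<open>f\<close>. The draws of \<open>p\<close> from
      \<open>P\<close> and of \<open>g\<close> from \<open>q\<close> are independent and may be
      exchanged.\<close>
    also have "\<dots> = dist_bind Q (\<lambda>q. dist_bind q (\<lambda>g. dist_bind P (\<lambda>p. dist_bind p
          (\<lambda>f. delta (Comp C X Y Z g f)))))"
      by (subst dist_bind_commute[of P]) (rule refl)
    finally show ?thesis
      using P Q by (simp add: Hom_dist_cat[of _ "?DC"] s Comp_dist_cat dist_bind_assoc)
  qed
qed (simp_all, simp_all add: dist_cat_mult_def)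

section \<open>Convex categories and the adjunction\<close>

text \<open>Both algebra laws are equations of extensional functors, so they can be checked on
  objects and morphisms. The right-hand side of \<open>mult\<close> is \<pi> applied to the image of
  \<open>P\<close> under \<open>D_R\<close> of \<pi>, written as a bind so that instances become
  computations with the monad laws.\<close>

lemma convex_categoryI:
  fixes \<pi> :: "('o, 'm \<Rightarrow> 'r::{comm_semiring_0, comm_monoid_mult}, 'o, 'm) cfunctor"
  assumes C: "category C" and \<pi>: "\<pi> \<in> functors (dist_cat C) C"
    and obj: "\<And>X. X \<in> Obj C \<Longrightarrow> obj_map \<pi> X = X"
    and unit: "\<And>X Y f. f \<in> Hom C X Y \<Longrightarrow> mor_map \<pi> X Y (delta f) = f"
    and mult: "\<And>X Y P. P \<in> Hom (dist_cat (dist_cat C)) X Y \<Longrightarrow>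
      mor_map \<pi> X Y (dist_bind P (\<lambda>p. p)) =
      mor_map \<pi> X Y (dist_bind P (\<lambda>p. delta (mor_map \<pi> X Y p)))"
  shows "convex_category (C, \<pi>)"
proof -
  note DC = category_dist_cat[OF C]
  note DDC = category_dist_cat[OF DC]
  have "comp_functor C \<pi> (dist_cat_unit C) = id_functor C"
  proof (rule functor_eqI)
    show "comp_functor C \<pi> (dist_cat_unit C) \<in> functors C C"
      by (rule comp_functor_in_functors[OF C dist_cat_unit_in_functors[OF C] \<pi>])
    show "id_functor C \<in> functors C C"
      by (rule functorI[OF C])
        (auto simp: id_functor_def category_ident[OF C] category_comp[OF C])
  qed (use category_objects[OF C] in \<open>simp_all add: id_functor_def obj unit\<close>)
  moreover have "comp_functor (dist_cat (dist_cat C)) \<pi> (dist_cat_mult C) =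
      comp_functor (dist_cat (dist_cat C)) \<pi> (dist_cat_map (dist_cat C) \<pi>)"
  proof (rule functor_eqI)
    show "comp_functor (dist_cat (dist_cat C)) \<pi> (dist_cat_mult C) \<in>
        functors (dist_cat (dist_cat C)) C"
      by (rule comp_functor_in_functors[OF DDC dist_cat_mult_in_functors[OF C] \<pi>])
    show "comp_functor (dist_cat (dist_cat C)) \<pi> (dist_cat_map (dist_cat C) \<pi>) \<in>
        functors (dist_cat (dist_cat C)) C"
      by (rule comp_functor_in_functors[OF DDC dist_cat_map_in_functors[OF DC \<pi>] \<pi>])
    fix X Y and P :: "('m \<Rightarrow> 'r) \<Rightarrow> 'r" assume P: "P \<in> Hom (dist_cat (dist_cat C)) X Y"
    show "mor_map (comp_functor (dist_cat (dist_cat C)) \<pi> (dist_cat_mult C)) X Y P =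
        mor_map (comp_functor (dist_cat (dist_cat C)) \<pi> (dist_cat_map (dist_cat C) \<pi>)) X Y P"
      using P category_objects[OF DDC P] by (simp add: obj mult)
  qed (simp add: obj)
  ultimately show ?thesis using C \<pi> by (simp add: convex_category_def)
qed

text \<open>The unit law is the left unit law of \<open>dist_bind\<close>, and the multiplication
  law is its associativity.\<close>

lemma convex_free_conv:
  fixes C :: "('o, 'm) precat"
  assumes C: "category C"
  shows "convex_category
    (free_conv C :: ('o, 'm \<Rightarrow> 'r, 'r::{comm_semiring_0, comm_monoid_mult}) conv_cat)"
  unfolding free_conv_def
proof (rule convex_categoryI[OF category_dist_cat[OF C] dist_cat_mult_in_functors[OF C]])
  let ?DC = "dist_cat C :: ('o, 'm \<Rightarrow> 'r) precat"
  let ?DDC = "dist_cat ?DC :: ('o, ('m \<Rightarrow> 'r) \<Rightarrow> 'r) precat"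
  let ?DDDC = "dist_cat ?DDC :: ('o, (('m \<Rightarrow> 'r) \<Rightarrow> 'r) \<Rightarrow> 'r) precat"
  let ?\<mu> = "dist_cat_mult C :: ('o, ('m \<Rightarrow> 'r) \<Rightarrow> 'r, 'o, 'm \<Rightarrow> 'r) cfunctor"
  note DC = category_dist_cat[OF C]
  {
    fix X Y f assume f: "f \<in> Hom ?DC X Y"
    then have "delta f \<in> Hom ?DDC X Y"
      unfolding Hom_dist_cat[of _ ?DC] by (simp add: delta_in_dist) (simp add: Hom_dist_cat)
    then show "mor_map ?\<mu> X Y (delta f) = f" by simp
  next
    fix X Y P assume P: "P \<in> Hom ?DDDC X Y"
    then have "X \<in> Obj C" "Y \<in> Obj C" by (simp_all add: Hom_dist_cat)
    \<comment> \<open>These are the images of \<open>P\<close> under the multiplication of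
      \<open>?DC\<close> and under \<open>D_R\<close> of the multiplication of \<open>C\<close>;
      functoriality of both maps gives the membership needed to evaluate
      \<open>?\<mu>\<close>.\<close>
    then have "dist_bind P (\<lambda>p. p) \<in> Hom ?DDC X Y"
      "dist_bind P (\<lambda>p. delta (mor_map ?\<mu> X Y p)) \<in> Hom ?DDC X Y"
      using functor_mor[OF dist_cat_mult_in_functors[OF DC] P]
        functor_mor[OF dist_cat_map_in_functors[OF category_dist_cat[OF DC]
            dist_cat_mult_in_functors[OF C]] P] P
      by simp_all
    moreover have "fin_supp P" "P p \<noteq> 0 \<Longrightarrow> fin_supp p"
      "P p \<noteq> 0 \<Longrightarrow> p \<in> Hom ?DDC X Y" for p
      using P by (auto dest: Hom_dist_cat_support intro: Hom_dist_cat_fin_supp)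
    ultimately show "mor_map ?\<mu> X Y (dist_bind P (\<lambda>p. p)) =
        mor_map ?\<mu> X Y (dist_bind P (\<lambda>p. delta (mor_map ?\<mu> X Y p)))"
      by (simp add: dist_bind_assoc)
  }
qed simp

text \<open>The unit law on objects forces the structure map to fix objects; this simplifies the
  hom-set indices when the other laws are read off on morphisms.\<close>

lemma convex_categoryD:
  assumes "convex_category (D, \<rho>)"
  shows "category D"
    and "\<rho> \<in> functors (dist_cat D) D"
    and "X \<in> Obj D \<Longrightarrow> obj_map \<rho> X = X"
    and "f \<in> Hom D X Y \<Longrightarrow> mor_map \<rho> X Y (delta f) = f"
    and "P \<in> Hom (dist_cat (dist_cat D)) X Y \<Longrightarrow>
      mor_map \<rho> X Y (dist_bind P (\<lambda>p. p)) =
      mor_map \<rho> X Y (dist_bind P (\<lambda>p. delta (mor_map \<rho> X Y p)))"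
proof -
  have "comp_functor D \<rho> (dist_cat_unit D) = id_functor D"
    and mult: "comp_functor (dist_cat (dist_cat D)) \<rho> (dist_cat_mult D) =
       comp_functor (dist_cat (dist_cat D)) \<rho> (dist_cat_map (dist_cat D) \<rho>)"
    and D: "category D" and \<rho>: "\<rho> \<in> functors (dist_cat D) D"
    using assms by (simp_all add: convex_category_def)
  then have unit: "obj_map (comp_functor D \<rho> (dist_cat_unit D)) X = obj_map (id_functor D) X"
    "mor_map (comp_functor D \<rho> (dist_cat_unit D)) X Y f = mor_map (id_functor D) X Y f" for X Y f
    by simp_all
  show obj: "obj_map \<rho> X = X" if "X \<in> Obj D" for X
    using unit(1)[of X] that by (simp add: id_functor_def)
  show "mor_map \<rho> X Y (delta f) = f" if "f \<in> Hom D X Y"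
    using unit(2)[of X Y f] that category_objects[OF D that] by (simp add: id_functor_def)
  show "mor_map \<rho> X Y (dist_bind P (\<lambda>p. p)) =
      mor_map \<rho> X Y (dist_bind P (\<lambda>p. delta (mor_map \<rho> X Y p)))"
    if P: "P \<in> Hom (dist_cat (dist_cat D)) X Y"
    using arg_cong[OF mult, of "\<lambda>F. mor_map F X Y P"] P
      category_objects[OF category_dist_cat[OF category_dist_cat[OF D]] P]
    by (simp add: obj)
  show "category D" "\<rho> \<in> functors (dist_cat D) D" by fact+
qed

lemma conv_functors_free_iff:
  "H \<in> conv_functors (free_conv C) (D, \<rho>) \<longleftrightarrow> H \<in> functors (dist_cat C) D \<and>
    comp_functor (dist_cat (dist_cat C)) H (dist_cat_mult C) =
    comp_functor (dist_cat (dist_cat C)) \<rho> (dist_cat_map (dist_cat C) H)"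
  by (simp add: conv_functors_def free_conv_def)

text \<open>Naturality of the multiplication turns \<rho> o \<open>D_R(F)\<close> o \<mu> into
  \<rho> o \<mu> o \<open>D_R(D_R(F))\<close>, and the multiplication law of \<rho> replaces \<rho>
  o \<mu> by \<rho> o \<open>D_R\<close> of \<rho>.\<close>

lemma extension_in_conv_functors:
  fixes C :: "('o, 'm) precat"
    and \<rho> :: "('p, 'n \<Rightarrow> 'r::{comm_semiring_0, comm_monoid_mult}, 'p, 'n) cfunctor"
  assumes C: "category C" and A: "convex_category (D, \<rho>)" and F: "F \<in> functors C D"
  shows "comp_functor (dist_cat C) \<rho> (dist_cat_map C F) \<in> conv_functors (free_conv C) (D, \<rho>)"
    (is "?H \<in> _")
  unfolding conv_functors_free_iff
proof
  let ?DC = "dist_cat C :: ('o, 'm \<Rightarrow> 'r) precat"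
  let ?DDC = "dist_cat ?DC :: ('o, ('m \<Rightarrow> 'r) \<Rightarrow> 'r) precat"
  let ?DDD = "dist_cat (dist_cat D) :: ('p, ('n \<Rightarrow> 'r) \<Rightarrow> 'r) precat"
  note \<rho> = convex_categoryD(2)[OF A]
  note DC = category_dist_cat[OF C]
  note DDC = category_dist_cat[OF DC]
  show H: "?H \<in> functors ?DC D"
    by (rule comp_functor_in_functors[OF DC dist_cat_map_in_functors[OF C F] \<rho>])
  show "comp_functor ?DDC ?H (dist_cat_mult C) =
    comp_functor ?DDC \<rho> (dist_cat_map ?DC ?H)" (is "?L = ?R")
  proof (rule functor_eqI)
    show "?L \<in> functors ?DDC D"
      by (rule comp_functor_in_functors[OF DDC dist_cat_mult_in_functors[OF C] H])
    show "?R \<in> functors ?DDC D"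
      by (rule comp_functor_in_functors[OF DDC dist_cat_map_in_functors[OF DC H] \<rho>])
    show "obj_map ?L X = obj_map ?R X" if "X \<in> Obj ?DDC" for X
      using that functor_obj[OF F] by (simp add: convex_categoryD(3)[OF A])
    fix X Y P assume P: "P \<in> Hom ?DDC X Y"
    then have obj: "X \<in> Obj C" "Y \<in> Obj C" by (simp_all add: Hom_dist_cat)
    have s: "fin_supp P" "P p \<noteq> 0 \<Longrightarrow> fin_supp p" "P p \<noteq> 0 \<Longrightarrow> p \<in> Hom ?DC X Y" for p
      using P by (auto dest: Hom_dist_cat_support intro: Hom_dist_cat_fin_supp)
    have join: "dist_bind P (\<lambda>p. p) \<in> Hom ?DC X Y"
      using functor_mor[OF dist_cat_mult_in_functors[OF C] P] P obj by simp
    \<comment> \<open>This is \<open>D_R(D_R(F))\<close> at \<open>P\<close>, the distribution at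
      which the multiplication law of \<rho> is used below.\<close>
    have map: "dist_bind P (\<lambda>p. delta (dist_bind p (\<lambda>f. delta (mor_map F X Y f)))) \<in>
        Hom ?DDD (obj_map F X) (obj_map F Y)"
      using functor_mor[OF dist_cat_map_in_functors[OF DC dist_cat_map_in_functors[OF C F]] P] P
      by (simp add: s)
    show "mor_map ?L X Y P = mor_map ?R X Y P"
      using convex_categoryD(5)[OF A map] functor_obj[OF F] P join obj
      by (simp add: s dist_bind_assoc convex_categoryD(3)[OF A])
  qed
qed

section \<open>The hom-set bijection of the adjunction\<close>

lemma adj_bij_in_functors:
  assumes C: "category C" and H: "H \<in> functors (dist_cat C) D"
  shows "adj_bij C H \<in> functors C D"
  unfolding adj_bij_def by (rule comp_functor_in_functors[OF C dist_cat_unit_in_functors[OF C] H])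

text \<open>The extension sends \<open>delta f\<close> to \<rho> applied to the delta at the image
  of \<open>f\<close>, which is that image by the unit law of \<rho>.\<close>

lemma adj_bij_extension:
  fixes \<rho> :: "('p, 'n \<Rightarrow> 'r::{comm_semiring_0, comm_monoid_mult}, 'p, 'n) cfunctor"
  assumes C: "category C" and A: "convex_category (D, \<rho>)" and F: "F \<in> functors C D"
  shows "adj_bij C (comp_functor (dist_cat C) \<rho> (dist_cat_map C F)) = F" (is "adj_bij C ?H = F")
proof (rule functor_eqI[OF _ F])
  have "?H \<in> functors (dist_cat C) D"
    using extension_in_conv_functors[OF C A F] by (simp add: conv_functors_free_iff)
  then show "adj_bij C ?H \<in> functors C D" by (rule adj_bij_in_functors[OF C])
  show "obj_map (adj_bij C ?H) X = obj_map F X" if "X \<in> Obj C" for X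
    using that functor_obj[OF F] by (simp add: adj_bij_def convex_categoryD(3)[OF A])
  fix X Y f assume f: "f \<in> Hom C X Y"
  then have "(delta f :: _ \<Rightarrow> 'r) \<in> Hom (dist_cat C) X Y"
    using category_objects[OF C f] by (simp add: Hom_dist_cat delta_in_dist)
  then show "mor_map (adj_bij C ?H) X Y f = mor_map F X Y f"
    using f category_objects[OF C f] functor_mor[OF F f]
    by (simp add: adj_bij_def convex_categoryD(4)[OF A])
qed

text \<open>A convex functor \<open>H\<close> out of the free algebra satisfies
  \<open>H = H \<circ> \<mu> \<circ> D\<^sub>R(\<delta>) = \<pi> \<circ> D\<^sub>R(H \<circ> \<delta>)\<close>, so it is recovered from its transpose.\<close>

lemma bij_betw_adj_bij:
  fixes C :: "('o, 'm) precat"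
    and \<rho> :: "('p, 'n \<Rightarrow> 'r::{comm_semiring_0, comm_monoid_mult}, 'p, 'n) cfunctor"
  assumes C: "category C" and A: "convex_category (D, \<rho>)"
  shows "bij_betw (adj_bij C) (conv_functors (free_conv C) (D, \<rho>)) (functors C D)"
proof (rule bij_betw_byWitness[where f' = "\<lambda>F. comp_functor (dist_cat C) \<rho> (dist_cat_map C F)"])
  let ?DC = "dist_cat C :: ('o, 'm \<Rightarrow> 'r) precat"
  let ?DDC = "dist_cat ?DC :: ('o, ('m \<Rightarrow> 'r) \<Rightarrow> 'r) precat"
  note \<rho> = convex_categoryD(2)[OF A]
  note DC = category_dist_cat[OF C]
  note unit = adj_bij_in_functors[OF C]
  show "adj_bij C ` conv_functors (free_conv C) (D, \<rho>) \<subseteq> functors C D"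
    using unit by (auto simp: conv_functors_free_iff)
  show "(\<lambda>F. comp_functor ?DC \<rho> (dist_cat_map C F)) ` functors C D
      \<subseteq> conv_functors (free_conv C) (D, \<rho>)"
    using extension_in_conv_functors[OF C A] by auto
  show "\<forall>H\<in>conv_functors (free_conv C) (D, \<rho>).
      comp_functor ?DC \<rho> (dist_cat_map C (adj_bij C H)) = H"
  proof
    fix H assume "H \<in> conv_functors (free_conv C) (D, \<rho>)"
    then have H: "H \<in> functors ?DC D" and conv:
      "comp_functor ?DDC H (dist_cat_mult C) =
       comp_functor ?DDC \<rho> (dist_cat_map ?DC H)"
      by (simp_all add: conv_functors_free_iff)
    show "comp_functor ?DC \<rho> (dist_cat_map C (adj_bij C H)) = H" (is "?K = H")
    proof (rule functor_eqI[OF _ H])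
      show "?K \<in> functors ?DC D"
        by (rule comp_functor_in_functors[OF DC dist_cat_map_in_functors[OF C unit[OF H]] \<rho>])
      show "obj_map ?K X = obj_map H X" if "X \<in> Obj ?DC" for X
        using that functor_obj[OF H] by (simp add: adj_bij_def convex_categoryD(3)[OF A])
      fix X Y p assume p: "p \<in> Hom ?DC X Y"
      then have obj: "X \<in> Obj C" "Y \<in> Obj C" by (simp_all add: Hom_dist_cat)
      note s = Hom_dist_cat_fin_supp[OF p] Hom_dist_cat_support[OF p]
      \<comment> \<open>This is the image of \<open>p\<close> under \<open>D_R\<close> of the unit.
        Its join is \<open>p\<close> again, so evaluating \<open>conv\<close> at it expresses the
        value of \<open>H\<close> at \<open>p\<close> through values of \<open>H\<close> at
        deltas.\<close>
      let ?P = "dist_bind p (\<lambda>f. delta (delta f))"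
      have P: "?P \<in> Hom ?DDC X Y"
        using functor_mor[OF dist_cat_map_in_functors[OF C dist_cat_unit_in_functors[OF C]] p] p obj
        by (simp add: s)
      show "mor_map ?K X Y p = mor_map H X Y p"
        using arg_cong[OF conv, of "\<lambda>F. mor_map F X Y ?P"] P p obj
        by (simp add: s dist_bind_assoc adj_bij_def)
    qed
  qed
  show "\<forall>F\<in>functors C D. adj_bij C (comp_functor ?DC \<rho> (dist_cat_map C F)) = F"
    using adj_bij_extension[OF C A] by blast
qed

section \<open>Simplicial sets and the Kleisli category\<close>

lemma Hom_op_cat [simp]: "Hom (op_cat C) X Y = Hom C Y X"
  by (simp add: op_cat_def)

lemma sset_action:
  assumes "X \<in> ssets" "\<theta> \<in> Hom simplex_cat m n"
  shows "mor_map X n m \<theta> \<in> simplices X n \<rightarrow>\<^sub>E simplices X m"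
  using functor_mor[of X "op_cat simplex_cat" set_cat \<theta> n m] assms
  by (simp add: ssets_def set_cat_def)

lemma sset_action_simplex:
  assumes "X \<in> ssets" "\<theta> \<in> Hom simplex_cat m n" "x \<in> simplices X n"
  shows "mor_map X n m \<theta> x \<in> simplices X m"
  using sset_action[OF assms(1,2)] assms(3) by auto

lemma simplices_dist_sset [simp]: "simplices (dist_sset Y) n = dist (simplices Y n)"
  by (simp add: dist_sset_def comp_functor_def dist_functor_def op_cat_def simplex_cat_def)

text \<open>\<open>dist_functor\<close> is restricted to hom-sets of \<open>set_cat\<close> and to
  distributions; the assumptions place the action of \<open>Y\<close> and the argument
  \<open>p\<close> there.\<close>

lemma dist_sset_action:
  assumes "Y \<in> ssets" "\<theta> \<in> Hom simplex_cat m n" "p \<in> dist (simplices Y n)"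
  shows "mor_map (dist_sset Y) n m \<theta> p = dist_bind p (\<lambda>y. delta (mor_map Y n m \<theta> y))"
  using assms sset_action[OF assms(1,2)]
  by (simp add: dist_sset_def dist_functor_def set_cat_def dist_map_eq_bind dist_fin_supp)

lemma sset_maps_simplex:
  "\<phi> \<in> sset_maps X Y \<Longrightarrow> x \<in> simplices X n \<Longrightarrow> \<phi> n x \<in> simplices Y n"
  by (auto simp: sset_maps_def)

lemma sset_maps_extensional: "\<phi> \<in> sset_maps X Y \<Longrightarrow> \<phi> n \<in> extensional (simplices X n)"
  by (auto simp: sset_maps_def PiE_iff)

lemma sset_maps_natural:
  "\<phi> \<in> sset_maps X Y \<Longrightarrow> \<theta> \<in> Hom simplex_cat m n \<Longrightarrow> x \<in> simplices X n \<Longrightarrow>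
    \<phi> m (mor_map X n m \<theta> x) = mor_map Y n m \<theta> (\<phi> n x)"
  by (simp add: sset_maps_def)

lemma sset_mapsI:
  assumes "\<And>n. \<phi> n \<in> extensional (simplices X n)"
    and "\<And>n x. x \<in> simplices X n \<Longrightarrow> \<phi> n x \<in> simplices Y n"
    and "\<And>m n \<theta> x. \<theta> \<in> Hom simplex_cat m n \<Longrightarrow> x \<in> simplices X n \<Longrightarrow>
      \<phi> m (mor_map X n m \<theta> x) = mor_map Y n m \<theta> (\<phi> n x)"
  shows "\<phi> \<in> sset_maps X Y"
  using assms by (simp add: sset_maps_def PiE_iff)

lemma sset_map_eqI:
  assumes "\<And>n. \<phi> n \<in> extensional (simplices X n)" "\<And>n. \<psi> n \<in> extensional (simplices X n)"
    and "\<And>n x. x \<in> simplices X n \<Longrightarrow> \<phi> n x = \<psi> n x"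
  shows "\<phi> = \<psi>"
  by (rule ext) (rule extensionalityI[OF assms])

section \<open>The category of simplicial sets\<close>

lemma Obj_sset_cat [simp]: "Obj sset_cat = ssets"
  by (simp add: sset_cat_def)

lemma Hom_sset_cat:
  "\<phi> \<in> Hom sset_cat X Y \<longleftrightarrow> \<phi> \<in> sset_maps X Y \<and> X \<in> ssets \<and> Y \<in> ssets"
  by (simp add: sset_cat_def)

lemma Ident_sset_cat: "Ident sset_cat X n = (\<lambda>x \<in> simplices X n. x)"
  by (simp add: sset_cat_def)

lemma Comp_sset_cat: "Comp sset_cat X Y Z \<psi> \<phi> n = (\<lambda>x \<in> simplices X n. \<psi> n (\<phi> n x))"
  by (simp add: sset_cat_def sset_comp_def compose_def)

lemma category_sset_cat: "category sset_cat"
  unfolding category_def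
proof (intro conjI allI ballI impI)
  fix X Y :: "'a sset" assume "Hom sset_cat X Y \<noteq> {}"
  then show "X \<in> Obj sset_cat" "Y \<in> Obj sset_cat" by (auto simp: Hom_sset_cat)
next
  fix X :: "'a sset" assume "X \<in> Obj sset_cat"
  then show "Ident sset_cat X \<in> Hom sset_cat X X"
    by (auto simp: Hom_sset_cat Ident_sset_cat sset_action_simplex intro!: sset_mapsI)
next
  fix X Y Z :: "'a sset" and f g assume "f \<in> Hom sset_cat X Y" "g \<in> Hom sset_cat Y Z"
  then show "Comp sset_cat X Y Z g f \<in> Hom sset_cat X Z"
    by (auto simp: Hom_sset_cat Comp_sset_cat sset_action_simplex sset_maps_simplex
        sset_maps_natural intro!: sset_mapsI)
next
  fix X Y :: "'a sset" and f assume "f \<in> Hom sset_cat X Y"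
  then show "Comp sset_cat X Y Y (Ident sset_cat Y) f = f"
    "Comp sset_cat X X Y f (Ident sset_cat X) = f"
    by (auto simp: Hom_sset_cat Comp_sset_cat Ident_sset_cat sset_maps_simplex
        sset_maps_extensional intro!: sset_map_eqI[of _ X])
next
  fix W X Y Z :: "'a sset" and f g h
  assume "f \<in> Hom sset_cat W X" "g \<in> Hom sset_cat X Y" "h \<in> Hom sset_cat Y Z"
  then show "Comp sset_cat W Y Z h (Comp sset_cat W X Y g f) =
      Comp sset_cat W X Z (Comp sset_cat X Y Z h g) f"
    by (auto simp: Hom_sset_cat Comp_sset_cat sset_maps_simplex intro!: sset_map_eqI[of _ W])
qed

section \<open>The Kleisli category\<close>

lemma Obj_kleisli_cat [simp]: "Obj kleisli_cat = ssets"
  by (simp add: kleisli_cat_def)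

lemma Hom_kleisli_cat:
  "p \<in> Hom kleisli_cat X Y \<longleftrightarrow> p \<in> sset_maps X (dist_sset Y) \<and> X \<in> ssets \<and> Y \<in> ssets"
  by (simp add: kleisli_cat_def)

lemma Ident_kleisli_cat: "Ident kleisli_cat X n = (\<lambda>x \<in> simplices X n. delta x)"
  by (simp add: kleisli_cat_def sset_delta_def)

lemma Comp_kleisli_cat:
  "Comp kleisli_cat X Y Z q p n = (\<lambda>x \<in> simplices X n. dist_bind (p n x) (q n))"
  by (simp add: kleisli_cat_def dist_bind_def)

lemma Hom_kleisli_cat_dist:
  "p \<in> Hom kleisli_cat X Y \<Longrightarrow> x \<in> simplices X n \<Longrightarrow> p n x \<in> dist (simplices Y n)"
  using sset_maps_simplex[of p X "dist_sset Y"] by (simp add: Hom_kleisli_cat)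

lemma Hom_kleisli_cat_extensional:
  "p \<in> Hom kleisli_cat X Y \<Longrightarrow> p n \<in> extensional (simplices X n)"
  by (auto simp: Hom_kleisli_cat intro: sset_maps_extensional)

lemma Hom_kleisli_cat_natural:
  assumes "p \<in> Hom kleisli_cat X Y" "\<theta> \<in> Hom simplex_cat m n" "x \<in> simplices X n"
  shows "p m (mor_map X n m \<theta> x) = dist_bind (p n x) (\<lambda>y. delta (mor_map Y n m \<theta> y))"
  using sset_maps_natural[of p X "dist_sset Y", OF _ assms(2,3)] assms(1)
    dist_sset_action[OF _ assms(2) Hom_kleisli_cat_dist[OF assms(1,3)]]
  by (simp add: Hom_kleisli_cat)

lemma Hom_kleisli_catI:
  assumes "X \<in> ssets" "Y \<in> ssets"
    and "\<And>n. p n \<in> extensional (simplices X n)"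
    and "\<And>n x. x \<in> simplices X n \<Longrightarrow> p n x \<in> dist (simplices Y n)"
    and "\<And>m n \<theta> x. \<theta> \<in> Hom simplex_cat m n \<Longrightarrow> x \<in> simplices X n \<Longrightarrow>
      p m (mor_map X n m \<theta> x) = dist_bind (p n x) (\<lambda>y. delta (mor_map Y n m \<theta> y))"
  shows "p \<in> Hom kleisli_cat X Y"
  unfolding Hom_kleisli_cat using assms by (auto simp: dist_sset_action intro!: sset_mapsI)

lemma Hom_kleisli_cat_fin_supp:
  "p \<in> Hom kleisli_cat X Y \<Longrightarrow> x \<in> simplices X n \<Longrightarrow> fin_supp (p n x)"
  by (rule dist_fin_supp[OF Hom_kleisli_cat_dist])

lemma Hom_kleisli_cat_support:
  "p \<in> Hom kleisli_cat X Y \<Longrightarrow> x \<in> simplices X n \<Longrightarrow> p n x y \<noteq> 0 \<Longrightarrow> y \<in> simplices Y n"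
  by (rule dist_support[OF Hom_kleisli_cat_dist])

lemma Hom_kleisli_cat_objects:
  "p \<in> Hom kleisli_cat X Y \<Longrightarrow> X \<in> ssets \<and> Y \<in> ssets"
  by (simp add: Hom_kleisli_cat)

lemma category_kleisli_cat:
  "category (kleisli_cat ::
    ('a sset, ('a, 'a \<Rightarrow> 'r::{comm_semiring_0, comm_monoid_mult}) sset_map) precat)"
  (is "category ?K")
  unfolding category_def
proof (intro conjI allI ballI impI)
  fix X Y assume "Hom ?K X Y \<noteq> {}"
  then show "X \<in> Obj ?K" "Y \<in> Obj ?K" by (auto simp: Hom_kleisli_cat)
next
  fix X assume "X \<in> Obj ?K"
  then show "Ident ?K X \<in> Hom ?K X X"
    by (auto simp: Ident_kleisli_cat sset_action_simplex delta_in_dist intro!: Hom_kleisli_catI)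
next
  fix X Y Z f g assume f: "f \<in> Hom ?K X Y" and g: "g \<in> Hom ?K Y Z"
  show "Comp ?K X Y Z g f \<in> Hom ?K X Z"
  proof (rule Hom_kleisli_catI)
    \<comment> \<open>Naturality of \<open>f\<close> moves \<theta> to the simplices drawn from
      \<open>f n x\<close>. These lie in \<open>simplices Y n\<close>, so naturality of
      \<open>g\<close> moves it past \<open>g\<close> under the binder.\<close>
    fix m n \<theta> x assume \<theta>: "\<theta> \<in> Hom simplex_cat m n" and x: "x \<in> simplices X n"
    then show "Comp ?K X Y Z g f m (mor_map X n m \<theta> x) =
        dist_bind (Comp ?K X Y Z g f n x) (\<lambda>z. delta (mor_map Z n m \<theta> z))"
      using Hom_kleisli_cat_objects[OF f]
      by (simp add: Comp_kleisli_cat sset_action_simplex Hom_kleisli_cat_natural[OF f]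
          Hom_kleisli_cat_natural[OF g] dist_bind_assoc Hom_kleisli_cat_fin_supp[OF f]
          Hom_kleisli_cat_support[OF f x] Hom_kleisli_cat_fin_supp[OF g])
  qed (use Hom_kleisli_cat_objects[OF f] Hom_kleisli_cat_objects[OF g] in
      \<open>auto simp: Comp_kleisli_cat intro!: dist_bind_in_dist[OF Hom_kleisli_cat_dist[OF f]]
        Hom_kleisli_cat_dist[OF g]\<close>)
next
  fix X Y f assume f: "f \<in> Hom ?K X Y"
  show "Comp ?K X Y Y (Ident ?K Y) f = f"
  proof (rule sset_map_eqI[of _ X])
    fix n x assume x: "x \<in> simplices X n"
    then show "Comp ?K X Y Y (Ident ?K Y) f n x = f n x"
      by (simp add: Comp_kleisli_cat Ident_kleisli_cat Hom_kleisli_cat_support[OF f x]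
          Hom_kleisli_cat_fin_supp[OF f])
  qed (simp_all add: Comp_kleisli_cat Hom_kleisli_cat_extensional[OF f])
  show "Comp ?K X X Y f (Ident ?K X) = f"
    by (rule sset_map_eqI[of _ X])
      (simp_all add: Comp_kleisli_cat Ident_kleisli_cat Hom_kleisli_cat_extensional[OF f])
next
  fix W X Y Z f g h
  assume f: "f \<in> Hom ?K W X" and g: "g \<in> Hom ?K X Y" and h: "h \<in> Hom ?K Y Z"
  show "Comp ?K W Y Z h (Comp ?K W X Y g f) = Comp ?K W X Z (Comp ?K X Y Z h g) f"
  proof (rule sset_map_eqI[of _ W])
    fix n x assume x: "x \<in> simplices W n"
    then show "Comp ?K W Y Z h (Comp ?K W X Y g f) n x =
        Comp ?K W X Z (Comp ?K X Y Z h g) f n x"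
      by (simp add: Comp_kleisli_cat Hom_kleisli_cat_support[OF f x] dist_bind_assoc
          Hom_kleisli_cat_fin_supp[OF f] Hom_kleisli_cat_fin_supp[OF g])
  qed (simp_all add: Comp_kleisli_cat)
qed

section \<open>The convex structure of the Kleisli category\<close>

lemma kleisli_struct_obj [simp]: "X \<in> ssets \<Longrightarrow> obj_map kleisli_struct X = X"
  by (simp add: kleisli_struct_def)

lemma kleisli_struct_mor:
  "Q \<in> Hom (dist_cat kleisli_cat) X Y \<Longrightarrow>
    mor_map kleisli_struct X Y Q n = (\<lambda>x \<in> simplices X n. dist_bind Q (\<lambda>p. p n x))"
  by (simp add: kleisli_struct_def dist_bind_def)

lemma kleisli_struct_in_functors:
  "kleisli_struct \<in> functors (dist_cat kleisli_cat)
    (kleisli_cat :: ('a sset, ('a, 'a \<Rightarrow> 'r::{comm_semiring_0, comm_monoid_mult}) sset_map) precat)"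
  (is "?\<pi> \<in> functors ?DK ?K")
proof (rule functorI[OF category_dist_cat[OF category_kleisli_cat]])
  fix X assume X: "X \<in> Obj ?DK"
  then have "delta (Ident ?K X) \<in> Hom ?DK X X"
    by (simp add: Hom_dist_cat delta_in_dist category_ident[OF category_kleisli_cat])
  then show "mor_map ?\<pi> X X (Ident ?DK X) = Ident ?K (obj_map ?\<pi> X)"
    using X by (intro ext) (simp add: kleisli_struct_mor Ident_kleisli_cat)
next
  fix X Y Q assume Q: "Q \<in> Hom ?DK X Y"
  then have obj: "X \<in> ssets" "Y \<in> ssets" by (simp_all add: Hom_dist_cat)
  note s = Hom_dist_cat_fin_supp[OF Q] Hom_dist_cat_support[OF Q]
  have "mor_map ?\<pi> X Y Q \<in> Hom ?K X Y"
  proof (rule Hom_kleisli_catI[OF obj])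
    show "mor_map ?\<pi> X Y Q n \<in> extensional (simplices X n)" for n
      by (simp add: kleisli_struct_mor[OF Q])
    show "mor_map ?\<pi> X Y Q n x \<in> dist (simplices Y n)" if "x \<in> simplices X n" for n x
    proof -
      have "Q \<in> dist (Hom ?K X Y)" using Q by (simp add: Hom_dist_cat)
      then have "dist_bind Q (\<lambda>p. p n x) \<in> dist (simplices Y n)"
        by (rule dist_bind_in_dist) (rule Hom_kleisli_cat_dist[OF _ that])
      then show ?thesis using that by (simp add: kleisli_struct_mor[OF Q])
    qed
    show "mor_map ?\<pi> X Y Q m (mor_map X n m \<theta> x) =
        dist_bind (mor_map ?\<pi> X Y Q n x) (\<lambda>y. delta (mor_map Y n m \<theta> y))"
      if "\<theta> \<in> Hom simplex_cat m n" "x \<in> simplices X n" for m n \<theta> x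
      using that obj
      by (simp add: kleisli_struct_mor[OF Q] sset_action_simplex dist_bind_assoc s
          Hom_kleisli_cat_fin_supp[OF s(2)] Hom_kleisli_cat_natural[OF s(2)])
  qed
  then show "mor_map ?\<pi> X Y Q \<in> Hom ?K (obj_map ?\<pi> X) (obj_map ?\<pi> Y)" using obj by simp
next
  fix X Y Z p q
  assume p: "p \<in> Hom ?DK X Y" and q: "q \<in> Hom ?DK Y Z"
  then have obj: "X \<in> ssets" "Y \<in> ssets" "Z \<in> ssets" by (simp_all add: Hom_dist_cat)
  have s: "fin_supp p" "fin_supp q"
    "p f \<noteq> 0 \<Longrightarrow> f \<in> Hom ?K X Y" "q g \<noteq> 0 \<Longrightarrow> g \<in> Hom ?K Y Z" for f g
    using p q by (auto intro: Hom_dist_cat_fin_supp Hom_dist_cat_support)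
  note qp = Comp_dist_cat_in_Hom[OF category_kleisli_cat p q]
  have "mor_map ?\<pi> X Z (Comp ?DK X Y Z q p) =
      Comp ?K X Y Z (mor_map ?\<pi> Y Z q) (mor_map ?\<pi> X Y p)"
  proof (rule sset_map_eqI[of _ X])
    fix n x assume x: "x \<in> simplices X n"
    have "mor_map ?\<pi> X Z (Comp ?DK X Y Z q p) n x =
        dist_bind q (\<lambda>g. dist_bind p (\<lambda>f. dist_bind (f n x) (g n)))"
      unfolding kleisli_struct_mor[OF qp]
      using x by (simp add: s Comp_dist_cat dist_bind_assoc Comp_kleisli_cat)
    \<comment> \<open>Composing the averaged maps draws \<open>f\<close>, then \<open>y\<close> from
      \<open>f n x\<close>, then \<open>g\<close>. Two exchanges move the draw of \<open>g\<close>
      from the front past \<open>f\<close> and past \<open>y\<close>.\<close>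
    also have "\<dots> = dist_bind p (\<lambda>f. dist_bind q (\<lambda>g. dist_bind (f n x) (g n)))"
      by (rule dist_bind_commute)
    also have "\<dots> = dist_bind p (\<lambda>f. dist_bind (f n x) (\<lambda>y. dist_bind q (\<lambda>g. g n y)))"
      by (subst dist_bind_commute[of q]) (rule refl)
    \<comment> \<open>The averaged map is restricted to \<open>simplices Y n\<close>, which contains
      every \<open>y\<close> in the support of \<open>f n x\<close>.\<close>
    also have "\<dots> = dist_bind p (\<lambda>f. dist_bind (f n x) (mor_map ?\<pi> Y Z q n))"
      using x by (simp add: kleisli_struct_mor[OF q] s Hom_kleisli_cat_support[OF s(3)])
    also have "\<dots> = Comp ?K X Y Z (mor_map ?\<pi> Y Z q) (mor_map ?\<pi> X Y p) n x"
      using x by (simp add: Comp_kleisli_cat kleisli_struct_mor[OF p] dist_bind_assoc s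
          Hom_kleisli_cat_fin_supp[OF s(3)])
    finally show "mor_map ?\<pi> X Z (Comp ?DK X Y Z q p) n x =
      Comp ?K X Y Z (mor_map ?\<pi> Y Z q) (mor_map ?\<pi> X Y p) n x" .
  qed (simp_all add: kleisli_struct_mor[OF qp] Comp_kleisli_cat)
  then show "mor_map ?\<pi> X Z (Comp ?DK X Y Z q p) =
      Comp ?K (obj_map ?\<pi> X) (obj_map ?\<pi> Y) (obj_map ?\<pi> Z)
        (mor_map ?\<pi> Y Z q) (mor_map ?\<pi> X Y p)"
    using obj by simp
qed (simp_all, simp_all add: kleisli_struct_def)

text \<open>At a fixed simplex \<open>x\<close> the structure map is a bind with the evaluation
  \<open>\<lambda>p. p n x\<close>, so the two laws reduce to the left unit law and
  associativity.\<close>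

lemma convex_kleisli_conv:
  "convex_category (kleisli_conv ::
    ('a sset, ('a, 'a \<Rightarrow> 'r) sset_map, 'r::{comm_semiring_0, comm_monoid_mult}) conv_cat)"
  unfolding kleisli_conv_def
proof (rule convex_categoryI[OF category_kleisli_cat kleisli_struct_in_functors])
  let ?K = "kleisli_cat :: ('a sset, ('a, 'a \<Rightarrow> 'r) sset_map) precat"
  let ?DK = "dist_cat ?K :: ('a sset, ('a, 'a \<Rightarrow> 'r) sset_map \<Rightarrow> 'r) precat"
  let ?DDK = "dist_cat ?DK :: ('a sset, (('a, 'a \<Rightarrow> 'r) sset_map \<Rightarrow> 'r) \<Rightarrow> 'r) precat"
  let ?\<pi> = "kleisli_struct :: ('a sset, ('a, 'a \<Rightarrow> 'r) sset_map \<Rightarrow> 'r, 'a sset,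
    ('a, 'a \<Rightarrow> 'r) sset_map) cfunctor"
  {
    fix X Y f assume f: "f \<in> Hom ?K X Y"
    then have "delta f \<in> Hom ?DK X Y"
      by (simp add: Hom_dist_cat delta_in_dist) (simp add: Hom_kleisli_cat)
    then show "mor_map ?\<pi> X Y (delta f) = f"
      by (intro sset_map_eqI[of _ X])
        (simp_all add: kleisli_struct_mor Hom_kleisli_cat_extensional[OF f])
  next
    fix X Y P assume P: "P \<in> Hom ?DDK X Y"
    then have obj: "X \<in> ssets" "Y \<in> ssets" by (simp_all add: Hom_dist_cat)
    have s: "fin_supp P" "P p \<noteq> 0 \<Longrightarrow> fin_supp p" "P p \<noteq> 0 \<Longrightarrow> p \<in> Hom ?DK X Y" for p
      using P by (auto dest: Hom_dist_cat_support intro: Hom_dist_cat_fin_supp)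
    have join: "dist_bind P (\<lambda>p. p) \<in> Hom ?DK X Y"
      using functor_mor[OF dist_cat_mult_in_functors[OF category_kleisli_cat] P] P obj by simp
    have map: "dist_bind P (\<lambda>p. delta (mor_map ?\<pi> X Y p)) \<in> Hom ?DK X Y"
      using functor_mor[OF dist_cat_map_in_functors[OF category_dist_cat[OF category_kleisli_cat]
            kleisli_struct_in_functors] P] P obj
      by simp
    show "mor_map ?\<pi> X Y (dist_bind P (\<lambda>p. p)) =
        mor_map ?\<pi> X Y (dist_bind P (\<lambda>p. delta (mor_map ?\<pi> X Y p)))"
      by (rule sset_map_eqI[of _ X])
        (simp_all add: kleisli_struct_mor[OF join] kleisli_struct_mor[OF map] dist_bind_assoc s
          kleisli_struct_mor)
  }
qed simp

section \<open>The functor into the Kleisli category and its transpose\<close>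

lemma F_functor_obj [simp]: "X \<in> ssets \<Longrightarrow> obj_map F_functor X = X"
  by (simp add: F_functor_def)

lemma F_functor_mor:
  "f \<in> Hom sset_cat X Y \<Longrightarrow>
    mor_map F_functor X Y f n = (\<lambda>x \<in> simplices X n. delta (f n x))"
  by (auto simp: F_functor_def sset_comp_def compose_def sset_delta_def Hom_sset_cat
      sset_maps_simplex)

lemma F_functor_in_functors:
  "F_functor \<in> functors sset_cat
    (kleisli_cat :: ('a sset, ('a, 'a \<Rightarrow> 'r::{comm_semiring_0, comm_monoid_mult}) sset_map) precat)"
  (is "?F \<in> functors ?S ?K")
proof (rule functorI[OF category_sset_cat])
  fix X assume "X \<in> Obj ?S"
  then show "mor_map ?F X X (Ident ?S X) = Ident ?K (obj_map ?F X)"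
    using category_ident[OF category_sset_cat, of X]
    by (intro ext) (simp add: F_functor_mor Ident_kleisli_cat Ident_sset_cat)
next
  fix X Y f assume f: "f \<in> Hom ?S X Y"
  then show "mor_map ?F X Y f \<in> Hom ?K (obj_map ?F X) (obj_map ?F Y)"
    by (auto simp: F_functor_mor[OF f] Hom_sset_cat sset_action_simplex sset_maps_natural[of f X Y]
        sset_maps_simplex delta_in_dist intro!: Hom_kleisli_catI)
next
  fix X Y Z f g assume f: "f \<in> Hom ?S X Y" and g: "g \<in> Hom ?S Y Z"
  then show "mor_map ?F X Z (Comp ?S X Y Z g f) =
      Comp ?K (obj_map ?F X) (obj_map ?F Y) (obj_map ?F Z) (mor_map ?F Y Z g) (mor_map ?F X Y f)"
    using category_comp[OF category_sset_cat f g]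
    by (intro ext) (auto simp: F_functor_mor Comp_kleisli_cat Comp_sset_cat Hom_sset_cat
        sset_maps_simplex)
qed (simp_all, simp_all add: F_functor_def)

text \<open>The index sets of the two sums agree because the support of \<open>d\<close> consists of
  simplicial maps.\<close>

lemma Theta_eq_bind:
  assumes "d \<in> Hom (dist_cat sset_cat) X Y"
  shows "Theta X Y d n = (\<lambda>x \<in> simplices X n. dist_bind d (\<lambda>\<phi>. delta (\<phi> n x)))"
proof -
  have "\<phi> \<in> sset_maps X Y \<and> d \<phi> \<noteq> 0 \<longleftrightarrow> d \<phi> \<noteq> 0" for \<phi>
    using Hom_dist_cat_support[OF assms] by (auto simp: Hom_sset_cat)
  then show ?thesis by (simp add: Theta_def dist_bind_def)
qed

text \<open>Through this identification, functoriality, convexity and the transpose property of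
  \<open>Theta_functor\<close> all come from the general extension lemmas. On morphisms it is
  associativity followed by the left unit law, at each simplex.\<close>

lemma Theta_functor_eq_extension:
  "Theta_functor = comp_functor (dist_cat sset_cat) kleisli_struct (dist_cat_map sset_cat
    (F_functor :: ('a sset, ('a, 'a) sset_map, 'a sset,
      ('a, 'a \<Rightarrow> 'r::{comm_semiring_0, comm_monoid_mult}) sset_map) cfunctor))"
  (is "_ = comp_functor ?DS ?\<pi> (dist_cat_map _ ?F)")
proof -
  have "Theta X Y d = mor_map ?\<pi> (obj_map ?F X) (obj_map ?F Y) (mor_map (dist_cat_map sset_cat ?F) X Y d)"
    if d: "d \<in> Hom ?DS X Y" for X Y d
  proof (rule sset_map_eqI[of _ X])
    have obj: "X \<in> ssets" "Y \<in> ssets" using d by (simp_all add: Hom_dist_cat)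
    have map: "dist_bind d (\<lambda>f. delta (mor_map ?F X Y f)) \<in> Hom (dist_cat kleisli_cat) X Y"
      using functor_mor[OF dist_cat_map_in_functors[OF category_sset_cat F_functor_in_functors] d]
        d obj by simp
    note s = Hom_dist_cat_fin_supp[OF d] Hom_dist_cat_support[OF d]
    show "Theta X Y d n \<in> extensional (simplices X n)" for n
      by (simp add: Theta_eq_bind[OF d])
    show "mor_map ?\<pi> (obj_map ?F X) (obj_map ?F Y) (mor_map (dist_cat_map sset_cat ?F) X Y d) n \<in>
        extensional (simplices X n)" for n
      using obj d by (simp add: kleisli_struct_mor[OF map])
    show "Theta X Y d n x = mor_map ?\<pi> (obj_map ?F X) (obj_map ?F Y)
        (mor_map (dist_cat_map sset_cat ?F) X Y d) n x" if "x \<in> simplices X n" for n x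
      using that obj d
      by (simp add: Theta_eq_bind[OF d] kleisli_struct_mor[OF map] dist_bind_assoc s F_functor_mor)
  qed
  then show ?thesis
    by (auto simp: Theta_functor_def comp_functor_def intro!: ext)
qed

theorem proposition3p14:
  shows
    "category (sset_cat :: ('a sset, ('a, 'a) sset_map) precat) \<and>
     convex_category (kleisli_conv :: ('a sset, ('a, 'a \<Rightarrow> 'r) sset_map, 'r::{comm_semiring_0, comm_monoid_mult}) conv_cat) \<and>
     convex_category (free_conv (sset_cat :: ('a sset, ('a, 'a) sset_map) precat) ::
       ('a sset, ('a, 'a) sset_map \<Rightarrow> 'r, 'r) conv_cat) \<and>
     bij_betw (adj_bij sset_cat)
       (conv_functors (free_conv sset_cat)
         (kleisli_conv :: ('a sset, ('a, 'a \<Rightarrow> 'r) sset_map, 'r) conv_cat))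
       (functors (sset_cat :: ('a sset, ('a, 'a) sset_map) precat)
         (forget (kleisli_conv :: ('a sset, ('a, 'a \<Rightarrow> 'r) sset_map, 'r) conv_cat))) \<and>
     (F_functor :: ('a sset, ('a, 'a) sset_map, 'a sset, ('a, 'a \<Rightarrow> 'r) sset_map) cfunctor)
       \<in> functors sset_cat
           (forget (kleisli_conv :: ('a sset, ('a, 'a \<Rightarrow> 'r) sset_map, 'r) conv_cat)) \<and>
     (Theta_functor ::
         ('a sset, ('a, 'a) sset_map \<Rightarrow> 'r, 'a sset, ('a, 'a \<Rightarrow> 'r) sset_map) cfunctor)
       \<in> conv_functors (free_conv sset_cat) kleisli_conv \<and>
     adj_transpose sset_cat
         (kleisli_conv :: ('a sset, ('a, 'a \<Rightarrow> 'r) sset_map, 'r) conv_cat) F_functor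
       = Theta_functor"
proof -
  let ?S = "sset_cat :: ('a sset, ('a, 'a) sset_map) precat"
  let ?A = "kleisli_conv :: ('a sset, ('a, 'a \<Rightarrow> 'r) sset_map, 'r) conv_cat"
  let ?F = "F_functor :: ('a sset, ('a, 'a) sset_map, 'a sset, ('a, 'a \<Rightarrow> 'r) sset_map) cfunctor"
  let ?T = "Theta_functor ::
    ('a sset, ('a, 'a) sset_map \<Rightarrow> 'r, 'a sset, ('a, 'a \<Rightarrow> 'r) sset_map) cfunctor"
  have forget: "forget ?A = kleisli_cat" by (simp add: forget_def kleisli_conv_def)
  note A = convex_kleisli_conv[where 'a = 'a and 'r = 'r, unfolded kleisli_conv_def]
  have F: "?F \<in> functors ?S (forget ?A)" unfolding forget by (rule F_functor_in_functors)
  have T: "?T \<in> conv_functors (free_conv ?S) ?A"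
    unfolding Theta_functor_eq_extension kleisli_conv_def
    by (rule extension_in_conv_functors[OF category_sset_cat A F_functor_in_functors])
  have bij: "bij_betw (adj_bij ?S) (conv_functors (free_conv ?S) ?A) (functors ?S (forget ?A))"
    \<comment> \<open>The order matters: the equation \<open>forget\<close> matches only while
      \<open>kleisli_conv\<close> is still folded.\<close>
    unfolding forget unfolding kleisli_conv_def
    by (rule bij_betw_adj_bij[OF category_sset_cat A])
  have "adj_bij ?S ?T = ?F"
    unfolding Theta_functor_eq_extension
    by (rule adj_bij_extension[OF category_sset_cat A F_functor_in_functors])
  \<comment> \<open>The transpose is an inverse image under \<open>adj_bij\<close>; injectivity and
    membership of \<open>?T\<close> in the convex functors identify it.\<close>
  then have "adj_transpose ?S ?A ?F = ?T"
    unfolding adj_transpose_def using the_inv_into_f_f[OF bij_betw_imp_inj_on[OF bij] T] by simp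
  then show ?thesis
    using category_sset_cat convex_kleisli_conv convex_free_conv[OF category_sset_cat] bij F T
    by blast
qed

end
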